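(* There is a polynomial-time algorithm that, given a cubic graph $G$, outputs a partition $\mathcal{P}$ of $V(G)$ with $\mathrm{opt}(G)/d(\mathcal{P})\le \frac{4}{3}$, where $\mathrm{opt}(G)$ is the maximum density of a partition of $V(G)$. That is, \textsc{Max Dense Graph Partition} is polynomial-time $\frac43$-approximable on cubic graphs.
   Context: All graphs are finite, simple, undirected. For $S\subseteq V$, $d(S)=|E(S)|/|S|$ where $E(S)$ is the set of edges with both endpoints in $S$. For a partition $\mathcal{P}=\{V_1,\dots,V_k\}$ ($k\ge1$) of $V$ into nonempty parts, $d(\mathcal{P})=\sum_i d(V_i)$. \textsc{Max Dense Graph Partition}: given $G$, find a partition of $V$ (any number of parts) maximizing $d(\mathcal{P})$. A cubic graph is a graph in which every vertex has degree 3. *)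

theory Defs
  imports Complex_Main "HOL-Library.Disjoint_Sets" "HOL-Computational_Algebra.Polynomial"
begin

section \<open>Graphs and dense partitions\<close>

definition simple_graph :: "'a set \<Rightarrow> 'a set set \<Rightarrow> bool" where
  "simple_graph V E \<longleftrightarrow> finite V \<and> V \<noteq> {} \<and> (\<forall>e\<in>E. e \<subseteq> V \<and> card e = 2)"

definition vertex_degree :: "'a set set \<Rightarrow> 'a \<Rightarrow> nat" where
  "vertex_degree E v = card {e \<in> E. v \<in> e}"

definition cubic_graph :: "'a set \<Rightarrow> 'a set set \<Rightarrow> bool" where
  "cubic_graph V E \<longleftrightarrow> simple_graph V E \<and> (\<forall>v\<in>V. vertex_degree E v = 3)"

definition induced_edges :: "'a set set \<Rightarrow> 'a set \<Rightarrow> 'a set set" where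
  "induced_edges E S = {e \<in> E. e \<subseteq> S}"

definition subset_density :: "'a set set \<Rightarrow> 'a set \<Rightarrow> real" where
  "subset_density E S = real (card (induced_edges E S)) / real (card S)"

definition partition_density :: "'a set set \<Rightarrow> 'a set set \<Rightarrow> real" where
  "partition_density E P = (\<Sum>S\<in>P. subset_density E S)"

definition opt_density :: "'a set \<Rightarrow> 'a set set \<Rightarrow> real" where
  "opt_density V E = Max (partition_density E ` {P. partition_on V P})"

section \<open>A random access machine with running time\<close>

text \<open>
  Algorithms are structured programs over finitely many registers and an unbounded,
  indirectly addressable memory of natural numbers.  Every evaluation step has unit cost.
  The only arithmetic operations are addition and truncated subtraction: without
  multiplication, the bit length of stored numbers grows by at most a constant (depending on
  the program) per step, so running in polynomially many steps on this machine is equivalent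
  to running in polynomial time on a Turing machine.
\<close>

datatype aexp = Num nat | Reg nat | Mem aexp | Plus aexp aexp | Minus aexp aexp

datatype bexp = Less aexp aexp

datatype com =
    Skip
  | SetReg nat aexp
  | SetMem aexp aexp
  | Seq com com
  | Cond bexp com com
  | While bexp com

text \<open>The first component of a state holds the registers, the second one the memory.\<close>

type_synonym state = "(nat \<Rightarrow> nat) \<times> (nat \<Rightarrow> nat)"

fun aval :: "aexp \<Rightarrow> state \<Rightarrow> nat" where
  "aval (Num k) s = k"
| "aval (Reg x) s = fst s x"
| "aval (Mem a) s = snd s (aval a s)"
| "aval (Plus a b) s = aval a s + aval b s"
| "aval (Minus a b) s = aval a s - aval b s"

fun acost :: "aexp \<Rightarrow> nat" where
  "acost (Num k) = 1"
| "acost (Reg x) = 1"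
| "acost (Mem a) = acost a + 1"
| "acost (Plus a b) = acost a + acost b + 1"
| "acost (Minus a b) = acost a + acost b + 1"

fun bval :: "bexp \<Rightarrow> state \<Rightarrow> bool" where
  "bval (Less a b) s \<longleftrightarrow> aval a s < aval b s"

fun bcost :: "bexp \<Rightarrow> nat" where
  "bcost (Less a b) = acost a + acost b + 1"

text \<open>\<open>exec c s t s'\<close>: started in \<open>s\<close>, program \<open>c\<close> halts in \<open>s'\<close> after \<open>t\<close> steps.\<close>

inductive exec :: "com \<Rightarrow> state \<Rightarrow> nat \<Rightarrow> state \<Rightarrow> bool" where
  Skip: "exec Skip s 1 s"
| SetReg: "exec (SetReg x a) (r, m) (acost a + 1) (r(x := aval a (r, m)), m)"
| SetMem: "exec (SetMem a b) (r, m) (acost a + acost b + 1)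
             (r, m(aval a (r, m) := aval b (r, m)))"
| Seq: "exec c s t s' \<Longrightarrow> exec d s' u s'' \<Longrightarrow> exec (Seq c d) s (t + u) s''"
| CondTrue: "bval b s \<Longrightarrow> exec c s t s' \<Longrightarrow> exec (Cond b c d) s (bcost b + t) s'"
| CondFalse: "\<not> bval b s \<Longrightarrow> exec d s t s' \<Longrightarrow> exec (Cond b c d) s (bcost b + t) s'"
| WhileFalse: "\<not> bval b s \<Longrightarrow> exec (While b c) s (bcost b) s"
| WhileTrue: "bval b s \<Longrightarrow> exec c s t s' \<Longrightarrow> exec (While b c) s' u s''
    \<Longrightarrow> exec (While b c) s (bcost b + t + u) s''"

lemma exec_deterministic:
  "exec c s t s' \<Longrightarrow> exec c s u s'' \<Longrightarrow> u = t \<and> s'' = s'"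
proof (induction arbitrary: u s'' rule: exec.induct)
  case (Seq c s t s' d u' s2)
  from Seq.prems show ?case by cases (use Seq.IH in blast)
next
  case (CondTrue b s c t s' d)
  from CondTrue.prems show ?case by cases (use CondTrue in blast)+
next
  case (CondFalse b s d t s' c)
  from CondFalse.prems show ?case by cases (use CondFalse in blast)+
next
  case (WhileFalse b s c)
  from WhileFalse.prems show ?case by cases (use WhileFalse in auto)
next
  case (WhileTrue b s c t s' u' s2)
  from WhileTrue.prems show ?case by cases (use WhileTrue in blast)+
qed (auto elim: exec.cases)

section \<open>Encoding of inputs and outputs\<close>

text \<open>
  A graph is presented to a machine with its vertices named \<open>0, \<dots>, n - 1\<close> and its edges listed
  in arbitrary order, each edge once and with its endpoints in arbitrary order.
\<close>

definition encodes_graph :: "nat \<Rightarrow> (nat \<times> nat) list \<Rightarrow> nat set \<Rightarrow> nat set set \<Rightarrow> bool" where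
  "encodes_graph n es V E \<longleftrightarrow> V = {..<n} \<and>
     distinct (map (\<lambda>(u, v). {u, v}) es) \<and> set (map (\<lambda>(u, v). {u, v}) es) = E"

text \<open>
  Initially registers 0 and 1 hold the numbers of vertices and edges, and memory cells
  \<open>2 * i\<close> and \<open>2 * i + 1\<close> hold the endpoints of the \<open>i\<close>-th edge; everything else is 0.
\<close>

definition input_state :: "nat \<Rightarrow> (nat \<times> nat) list \<Rightarrow> state" where
  "input_state n es =
     ((\<lambda>x. if x = 0 then n else if x = 1 then length es else 0),
      (\<lambda>a. if a < 2 * length es
            then (if even a then fst else snd) (es ! (a div 2)) else 0))"

text \<open>On termination, memory cell \<open>v\<close> holds the label of the part containing vertex \<open>v\<close>.\<close>

definition output_partition :: "nat set \<Rightarrow> state \<Rightarrow> nat set set" where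
  "output_partition V s = (\<lambda>v. {u \<in> V. snd s u = snd s v}) ` V"

end

theory Submission
  imports Defs
begin

text \<open>
  The algorithm packs vertex-disjoint triangles greedily, partitions the remaining graph into
  stars (which have at most three leaves), and adds every vertex that is isolated in the
  remaining graph to a triangle next to it.  With \<open>\<tau>\<close> triangles there are at most \<open>\<tau>\<close>
  isolated vertices, since every triangle sends out three edges and every isolated vertex
  receives three.  A star on \<open>s \<le> 4\<close> vertices has density \<open>(s - 1) / s \<ge> 3 s / 16\<close>, a triangle
  with vertices attached has density at least \<open>1\<close>, and \<open>3 / 2\<close> if it became a \<open>K\<^sub>4\<close>.  So the value
  is at least \<open>3 (n - 4 \<tau>) / 16 + \<tau> + \<kappa> / 2\<close>, where \<open>\<kappa>\<close> is the number of \<open>K\<^sub>4\<close> components.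

  Conversely, by Mantel's theorem and the handshake lemma, a set of \<open>s\<close> vertices has density at
  most \<open>s / 4\<close>, plus \<open>1 / 4\<close> if it contains a triangle, plus another \<open>1 / 4\<close> if it is a \<open>K\<^sub>4\<close>.
  Two intersecting triangles of a cubic graph share two vertices, so disjoint triangles meet
  different packed triangles and no partition has more than \<open>\<tau>\<close> parts with a triangle.
  Hence the optimum is at most \<open>(n + \<tau> + \<kappa>) / 4\<close>, which is at most \<open>4 / 3\<close> of the above.
\<close>

section \<open>Density of vertex sets in cubic graphs\<close>

definition clique :: "'a set set \<Rightarrow> 'a set \<Rightarrow> bool" where
  "clique E S \<longleftrightarrow> (\<forall>u\<in>S. \<forall>v\<in>S. u \<noteq> v \<longrightarrow> {u, v} \<in> E)"

definition neighbours :: "'a set set \<Rightarrow> 'a \<Rightarrow> 'a set" where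
  "neighbours E v = {u. {v, u} \<in> E}"

locale cubic =
  fixes V :: "'a set" and E :: "'a set set"
  assumes cubic: "cubic_graph V E"
begin

section \<open>Degrees and neighbourhoods in a cubic graph\<close>

lemma finite_V: "finite V" and V_nonempty: "V \<noteq> {}"
  using cubic by (auto simp: cubic_graph_def simple_graph_def)

lemma edge: assumes "e \<in> E" shows "e \<subseteq> V" "card e = 2"
  using cubic assms by (auto simp: cubic_graph_def simple_graph_def)

lemma finite_E: "finite E"
  by (rule finite_subset[of _ "Pow V"]) (use edge finite_V in auto)

lemma finite_edge: "e \<in> E \<Longrightarrow> finite e"
  using edge(1) finite_V finite_subset by blast

lemma no_loop: "{v, v} \<notin> E"
  using edge(2)[of "{v, v}"] by auto

lemma edge_endpoints: assumes "{u, v} \<in> E" shows "u \<in> V" "v \<in> V" "u \<noteq> v"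
  using edge(1)[OF assms] no_loop[of u] assms by auto

lemma edgeE: assumes "e \<in> E" obtains u v where "e = {u, v}" "u \<noteq> v"
  using edge(2)[OF assms] by (auto simp: card_2_iff)

lemma neighbours_sym: "u \<in> neighbours E v \<longleftrightarrow> v \<in> neighbours E u"
  by (simp add: neighbours_def insert_commute)

lemma neighbours_subset: "neighbours E v \<subseteq> V - {v}"
  using edge_endpoints no_loop by (fastforce simp: neighbours_def)

lemma finite_neighbours: "finite (neighbours E v)"
  using neighbours_subset finite_V by (meson finite_Diff finite_subset)

lemma card_incident: "v \<in> V \<Longrightarrow> card {e \<in> E. v \<in> e} = 3"
  using cubic by (auto simp: cubic_graph_def vertex_degree_def)

text \<open>Since the graph is simple, \<open>u\<close> to \<open>{v, u}\<close> is a bijection from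
  the neighbours of \<open>v\<close> to the edges at \<open>v\<close>.\<close>

lemma card_neighbours: assumes "v \<in> V" shows "card (neighbours E v) = 3"
proof -
  have "bij_betw (\<lambda>u. {v, u}) (neighbours E v) {e \<in> E. v \<in> e}"
    unfolding bij_betw_def
  proof
    show "inj_on (\<lambda>u. {v, u}) (neighbours E v)"
      by (auto simp: inj_on_def doubleton_eq_iff)
    have "e \<in> (\<lambda>u. {v, u}) ` neighbours E v" if "e \<in> E" "v \<in> e" for e
    proof -
      obtain x y where "e = {x, y}" using edgeE \<open>e \<in> E\<close> by metis
      then obtain u where "e = {v, u}" using \<open>v \<in> e\<close> by (auto simp: insert_commute)
      then show ?thesis using \<open>e \<in> E\<close> by (auto simp: neighbours_def)
    qed
    then show "(\<lambda>u. {v, u}) ` neighbours E v = {e \<in> E. v \<in> e}"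
      by (auto simp: neighbours_def)
  qed
  then show ?thesis using bij_betw_same_card card_incident[OF assms] by metis
qed

section \<open>Counting the edges inside a vertex set\<close>

lemma finite_induced: "finite (induced_edges E S)"
  using finite_E by (simp add: induced_edges_def)

text \<open>Double counting of incidences between \<open>S\<close> and its induced edges: an edge
  has two ends in \<open>S\<close>, a vertex lies on at most three such edges.\<close>

lemma induced_edges_handshake:
  assumes "S \<subseteq> V" shows "2 * card (induced_edges E S) \<le> 3 * card S"
proof -
  have fS: "finite S" using assms finite_V finite_subset by blast
  let ?D = "induced_edges E S"
  have "2 * card ?D = (\<Sum>e\<in>?D. card {v \<in> S. v \<in> e})"
  proof -
    have "card {v \<in> S. v \<in> e} = 2" if "e \<in> ?D" for e
    proof -
      have "{v \<in> S. v \<in> e} = e" using that by (auto simp: induced_edges_def)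
      then show ?thesis using that edge(2) by (auto simp: induced_edges_def)
    qed
    then show ?thesis by simp
  qed
  also have "\<dots> = (\<Sum>v\<in>S. card {e \<in> ?D. v \<in> e})"
    by (rule sum_multicount_gen[symmetric]) (use fS finite_induced in auto)
  also have "\<dots> \<le> (\<Sum>v\<in>S. 3)"
  proof (rule sum_mono)
    fix v assume "v \<in> S"
    have "card {e \<in> ?D. v \<in> e} \<le> card {e \<in> E. v \<in> e}"
      by (rule card_mono) (use finite_E in \<open>auto simp: induced_edges_def\<close>)
    then show "card {e \<in> ?D. v \<in> e} \<le> 3" using card_incident \<open>v \<in> S\<close> assms by force
  qed
  finally show ?thesis by simp
qed

lemma induced_edges_subset: "induced_edges E S \<subseteq> {e. e \<subseteq> S \<and> card e = 2}"
  using edge(2) by (auto simp: induced_edges_def)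

lemma card_induced_le_choose:
  assumes "finite S" shows "card (induced_edges E S) \<le> card S choose 2"
proof -
  have "card (induced_edges E S) \<le> card {e. e \<subseteq> S \<and> card e = 2}"
    using assms by (intro card_mono induced_edges_subset) auto
  then show ?thesis using n_subsets[OF assms] by metis
qed

text \<open>Equality in the binomial bound leaves no pair of \<open>S\<close> uncovered; this serves
  to recognise a \<open>K4\<close> by its six edges.\<close>

lemma clique_if_all_edges:
  assumes "finite S" "card (induced_edges E S) = card S choose 2" shows "clique E S"
proof -
  have "induced_edges E S = {e. e \<subseteq> S \<and> card e = 2}"
    using assms n_subsets[OF assms(1)]
    by (intro card_subset_eq induced_edges_subset) auto
  then show ?thesis unfolding clique_def induced_edges_def
    by (smt (verit, best) card_2_iff empty_subsetI insert_subset mem_Collect_eq)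
qed

definition triangle :: "'a set \<Rightarrow> bool" where
  "triangle T \<longleftrightarrow> T \<subseteq> V \<and> card T = 3 \<and> clique E T"

text \<open>Mantel's theorem: remove the two ends of an edge; they have no common neighbour.\<close>

lemma triangle_free_edge_bound:
  assumes "S \<subseteq> V" "\<not> (\<exists>T\<subseteq>S. triangle T)"
  shows "4 * card (induced_edges E S) \<le> (card S)\<^sup>2"
  using assms
proof (induction "card S" arbitrary: S rule: less_induct)
  case less
  have fS: "finite S" using less.prems finite_V finite_subset by blast
  show ?case
  proof (cases "induced_edges E S = {}")
    case False
    then obtain e where e: "e \<in> E" "e \<subseteq> S" by (auto simp: induced_edges_def)
    obtain u v where "e = {u, v}" "u \<noteq> v" using edgeE e by metis
    with e have uv: "{u, v} \<in> E" "u \<in> S" "v \<in> S" "u \<noteq> v" by auto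
    define S' where "S' = S - {u, v}"
    have c: "card S = card S' + 2"
    proof -
      have "card {u, v} = 2" using uv by simp
      then show ?thesis unfolding S'_def
        using card_Diff_subset[of "{u,v}" S] card_mono[of S "{u,v}"] uv fS by auto
    qed
    have disj: "neighbours E u \<inter> neighbours E v \<inter> S' = {}"
    proof (rule ccontr)
      assume "\<not> ?thesis"
      then obtain w where w: "w \<in> S'" "{u, w} \<in> E" "{v, w} \<in> E" by (auto simp: neighbours_def)
      have "triangle {u, v, w}"
        using w uv less.prems(1) by (auto simp: triangle_def clique_def S'_def insert_commute)
      then show False using less.prems(2) w uv by (auto simp: S'_def)
    qed
    let ?A = "neighbours E u \<inter> S'" and ?B = "neighbours E v \<inter> S'"
    have "induced_edges E S \<subseteq> insert {u, v} (induced_edges E S') \<union> (\<lambda>w. {u, w}) ` ?A \<union> (\<lambda>w. {v, w}) ` ?B"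
    proof
      fix e assume "e \<in> induced_edges E S"
      then have e: "e \<in> E" "e \<subseteq> S" by (auto simp: induced_edges_def)
      obtain x y where xy: "e = {x, y}" "x \<noteq> y" using edgeE e by metis
      show "e \<in> insert {u, v} (induced_edges E S') \<union> (\<lambda>w. {u, w}) ` ?A \<union> (\<lambda>w. {v, w}) ` ?B"
      proof (cases "u \<in> e \<or> v \<in> e")
        case False
        then have "e \<in> induced_edges E S'" using e by (auto simp: induced_edges_def S'_def)
        then show ?thesis by simp
      next
        case True
        then obtain z w where zw: "e = {z, w}" "z = u \<or> z = v" "z \<noteq> w"
          using xy by (auto simp: insert_commute)
        show ?thesis
        proof (cases "w \<in> {u, v}")
          case True
          then have "e = {u, v}" using zw by auto
          then show ?thesis by simp
        next
          case False
          then have "w \<in> S'" "w \<in> neighbours E z" using zw e by (auto simp: S'_def neighbours_def)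
          then show ?thesis using zw by blast
        qed
      qed
    qed
    then have "card (induced_edges E S) \<le>
        card (insert {u, v} (induced_edges E S') \<union> (\<lambda>w. {u, w}) ` ?A \<union> (\<lambda>w. {v, w}) ` ?B)"
      by (rule card_mono[rotated]) (use finite_induced finite_neighbours in auto)
    also have "\<dots> \<le> card (insert {u, v} (induced_edges E S')) + card ?A + card ?B"
      using finite_neighbours
      by (intro order_trans[OF card_Un_le] add_mono card_image_le) auto
    also have "\<dots> \<le> Suc (card (induced_edges E S')) + card ?A + card ?B"
      by (simp add: card_insert_if finite_induced)
    finally have "card (induced_edges E S) \<le> Suc (card (induced_edges E S')) + card ?A + card ?B" .
    moreover have "card (?A \<union> ?B) = card ?A + card ?B"
      using finite_neighbours disj by (intro card_Un_disjoint) auto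
    moreover have "card (?A \<union> ?B) \<le> card S'" using fS by (intro card_mono) (auto simp: S'_def)
    moreover have "4 * card (induced_edges E S') \<le> (card S')\<^sup>2"
      by (rule less.hyps) (use c less.prems in \<open>auto simp: S'_def\<close>)
    \<comment> \<open>With \<open>s = card S'\<close>, at most \<open>s + 1\<close> edges disappear,
      and \<open>(s + 2)^2 - s^2 = 4 * (s + 1)\<close> pays for them exactly.\<close>
    ultimately show ?thesis unfolding c by (simp add: power2_eq_square algebra_simps)
  qed simp
qed

lemma choose_2_small: "(1::nat) choose 2 = 0" "(2::nat) choose 2 = 1" "(3::nat) choose 2 = 3"
  "(4::nat) choose 2 = 6" "(5::nat) choose 2 = 10"
  by (simp_all add: choose_two)

text \<open>After clearing denominators the claim is \<open>4 * e \<le> s * s\<close>, plus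
  \<open>s\<close> if there is a triangle, plus \<open>s\<close> for a \<open>K4\<close>. Mantel's
  bound settles the triangle-free case. Otherwise \<open>s \<ge> 6\<close> follows from
  \<open>4 * e \<le> 6 * s\<close>, \<open>s = 5\<close> from the handshake bound
  \<open>e \<le> 7\<close>, and \<open>s \<le> 4\<close> from the binomial bound, where
  \<open>s = 4\<close>, \<open>e = 6\<close> is the \<open>K4\<close>.\<close>

lemma subset_density_le:
  assumes "S \<subseteq> V" "S \<noteq> {}"
  shows "subset_density E S \<le> real (card S) / 4 + (if \<exists>T\<subseteq>S. triangle T then 1 / 4 else 0)
    + (if card S = 4 \<and> clique E S then 1 / 4 else 0)"
proof -
  have fS: "finite S" using assms finite_V finite_subset by blast
  define a b where "a \<longleftrightarrow> (\<exists>T\<subseteq>S. triangle T)" and "b \<longleftrightarrow> card S = 4 \<and> clique E S"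
  define e s where "e = card (induced_edges E S)" and "s = card S"
  have s: "s > 0" using fS assms by (simp add: s_def card_gt_0_iff)
  have h: "2 * e \<le> 3 * s" using induced_edges_handshake[OF assms(1)] by (simp add: e_def s_def)
  have k: "e \<le> s choose 2" using card_induced_le_choose[OF fS] by (simp add: e_def s_def)
  have "4 * e \<le> s * s + (if a then s else 0) + (if b then s else 0)"
  proof (cases a)
    case False
    then show ?thesis using triangle_free_edge_bound[OF assms(1)]
      by (simp add: e_def s_def a_def power2_eq_square del: not_ex)
  next
    case True
    have K4: b if "s = 4" "e = 6"
      using that clique_if_all_edges[OF fS] choose_2_small by (simp add: e_def s_def b_def)
    consider "s = 1" | "s = 2" | "s = 3" | "s = 4" | "s = 5" | "s \<ge> 6" using s by linarith
    then show ?thesis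
    proof cases
      case 1
      then have "e = 0" using k unfolding 1 choose_2_small by simp
      then show ?thesis by simp
    next
      case 6
      then have "6 * s \<le> s * s" by (rule mult_le_mono1)
      then have "4 * e \<le> s * s" using h by linarith
      then show ?thesis by (rule trans_le_add1[OF trans_le_add1])
    next
      case 4
      then show ?thesis using K4 True k choose_2_small by (cases "e = 6") auto
    qed (use k h True choose_2_small in auto)
  qed
  then have "real (4 * e) \<le> real (s * s + (if a then s else 0) + (if b then s else 0))"
    by (simp only: of_nat_le_iff)
  then have "real e / real s \<le> real s / 4 + (if a then 1 / 4 else 0) + (if b then 1 / 4 else 0)"
    using s by (cases a; cases b) (simp_all add: field_simps)
  then show ?thesis by (simp add: subset_density_def e_def s_def a_def b_def)
qed

section \<open>Intersections of triangles and the number of parts containing one\<close>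

lemma triangle_member_neighbours:
  assumes "triangle T" "v \<in> T" shows "T - {v} \<subseteq> neighbours E v"
  using assms by (auto simp: triangle_def clique_def neighbours_def)

lemma finite_triangle: "triangle T \<Longrightarrow> finite T"
  by (metis card.infinite triangle_def zero_neq_numeral)

text \<open>At a common vertex each triangle uses two of only three neighbours.\<close>

lemma card_triangle_Int:
  assumes "triangle T" "triangle T'" "T \<inter> T' \<noteq> {}"
  shows "card (T \<inter> T') \<ge> 2"
proof -
  obtain v where v: "v \<in> T" "v \<in> T'" using assms by auto
  have fin: "finite T" "finite T'" using assms finite_triangle by auto
  have c: "card (T - {v}) = 2" "card (T' - {v}) = 2"
    using assms v fin by (auto simp: triangle_def card_Diff_singleton)
  have "card ((T - {v}) \<union> (T' - {v})) \<le> card (neighbours E v)"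
    using triangle_member_neighbours assms v by (intro card_mono finite_neighbours) blast
  also have "\<dots> = 3" using card_neighbours v assms by (auto simp: triangle_def)
  finally have "card ((T - {v}) \<inter> (T' - {v})) \<ge> 1"
    using card_Un_Int[of "T - {v}" "T' - {v}"] c fin by auto
  moreover have "T \<inter> T' = insert v ((T - {v}) \<inter> (T' - {v}))" using v by auto
  then have "card (T \<inter> T') = Suc (card ((T - {v}) \<inter> (T' - {v})))"
    using fin by (simp add: card_insert_if)
  ultimately show ?thesis by linarith
qed

text \<open>In a maximal packing every triangle shares two vertices with a packed one, and one packed
  triangle cannot share two vertices with each of two disjoint triangles.\<close>

lemma card_disjoint_triangles_le:
  assumes TT: "finite \<T>" "\<And>T. T \<in> \<T> \<Longrightarrow> triangle T"
    and maximal: "\<And>T. triangle T \<Longrightarrow> T \<inter> \<Union>\<T> \<noteq> {}"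
    and P: "partition_on V P"
  shows "card {S \<in> P. \<exists>T\<subseteq>S. triangle T} \<le> card \<T>"
proof -
  define P' where "P' = {S \<in> P. \<exists>T\<subseteq>S. triangle T}"
  have P'_sub: "P' \<subseteq> P" by (auto simp: P'_def)
  have "\<exists>T\<in>\<T>. card (T \<inter> S) \<ge> 2" if "S \<in> P'" for S
  proof -
    from that have "\<exists>T\<subseteq>S. triangle T" by (simp add: P'_def)
    then obtain T' where T': "T' \<subseteq> S" "triangle T'" by metis
    then obtain T where T: "T \<in> \<T>" "T \<inter> T' \<noteq> {}" using maximal by blast
    have "card (T \<inter> T') \<ge> 2" using card_triangle_Int T T' TT by auto
    moreover have "card (T \<inter> T') \<le> card (T \<inter> S)"
      using T' TT T finite_triangle by (intro card_mono) auto
    ultimately show ?thesis using T(1) order_trans by blast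
  qed
  then obtain f where f: "\<And>S. S \<in> P' \<Longrightarrow> f S \<in> \<T> \<and> card (f S \<inter> S) \<ge> 2" by metis
  have "inj_on f P'"
  proof (rule inj_onI)
    fix S S' assume S: "S \<in> P'" "S' \<in> P'" "f S = f S'"
    show "S = S'"
    proof (rule ccontr)
      assume "S \<noteq> S'"
      then have "S \<inter> S' = {}" using disjointD[OF partition_onD2[OF P]] S P'_sub by blast
      have fin: "finite (f S)" using f S TT finite_triangle by blast
      have "card ((f S \<inter> S) \<union> (f S \<inter> S')) = card (f S \<inter> S) + card (f S \<inter> S')"
        using fin \<open>S \<inter> S' = {}\<close> by (intro card_Un_disjoint) auto
      moreover have "card ((f S \<inter> S) \<union> (f S \<inter> S')) \<le> card (f S)"
        using fin by (intro card_mono) auto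
      moreover have "card (f S) = 3" using f S TT by (auto simp: triangle_def)
      ultimately show False using f[OF S(1)] f[OF S(2)] S(3) by simp
    qed
  qed
  then have "card P' \<le> card \<T>" using f TT(1) by (intro card_inj_on_le) auto
  then show ?thesis by (simp only: P'_def)
qed

section \<open>Upper bound for an arbitrary partition\<close>

lemma sum_card_partition:
  assumes "partition_on V P" shows "(\<Sum>S\<in>P. real (card S)) = real (card V)"
proof -
  have "card V = (\<Sum>S\<in>P. card S)"
  proof -
    have "\<Union>P = V" "disjoint P" using assms by (auto simp: partition_on_def)
    then show ?thesis
      using card_Union_disjoint[of P] finite_V by (metis Sup_upper finite_subset)
  qed
  then show ?thesis by simp
qed

lemma finite_partition: "partition_on V P \<Longrightarrow> finite P"
  using finite_V by (metis finite_UnionD partition_on_def)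

text \<open>Summation of \<open>subset_density_le\<close> over the parts: the terms
  \<open>card S / 4\<close> add up to \<open>card V / 4\<close> for every partition, so only the two
  kinds of special parts remain to be counted.\<close>

lemma partition_density_le:
  assumes P: "partition_on V P"
  shows "partition_density E P \<le> (real (card V) + real (card {S \<in> P. \<exists>T\<subseteq>S. triangle T})
    + real (card {S \<in> P. card S = 4 \<and> clique E S})) / 4"
proof -
  have fP: "finite P" using finite_partition P .
  have "partition_density E P \<le> (\<Sum>S\<in>P. real (card S) / 4 + (if \<exists>T\<subseteq>S. triangle T then 1 / 4 else 0)
    + (if card S = 4 \<and> clique E S then 1 / 4 else 0))"
    unfolding partition_density_def
    by (intro sum_mono subset_density_le) (use P in \<open>auto simp: partition_on_def\<close>)
  also have "\<dots> = (\<Sum>S\<in>P. real (card S)) / 4 + (\<Sum>S\<in>P. if \<exists>T\<subseteq>S. triangle T then 1 / 4 else 0)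
     + (\<Sum>S\<in>P. if card S = 4 \<and> clique E S then 1 / 4 else 0)"
    by (simp only: sum.distrib sum_divide_distrib)
  also have "(\<Sum>S\<in>P. if \<exists>T\<subseteq>S. triangle T then 1 / 4 else 0)
      = real (card {S \<in> P. \<exists>T\<subseteq>S. triangle T}) / 4"
    using fP by (simp add: sum.If_cases Int_def)
  also have "(\<Sum>S\<in>P. if card S = 4 \<and> clique E S then 1 / 4 else 0)
      = real (card {S \<in> P. card S = 4 \<and> clique E S}) / 4"
    using fP by (simp add: sum.If_cases Int_def)
  finally show ?thesis using sum_card_partition[OF P] by (simp add: add_divide_distrib)
qed

section \<open>Lower bounds for the parts built by the algorithm\<close>

definition star_part :: "'a set \<Rightarrow> bool" where
  "star_part S \<longleftrightarrow> card S \<ge> 2 \<and> (\<exists>c\<in>S. S - {c} \<subseteq> neighbours E c)"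

text \<open>The vertices outside \<open>T\<close> avoid all packed triangles, so \<open>S\<close>
  determines \<open>T\<close>; their neighbourhoods are covered by the packing, so
  \<open>card_isolated_le\<close> limits their number.\<close>

definition triangle_part :: "'a set set \<Rightarrow> 'a set \<Rightarrow> 'a set \<Rightarrow> bool" where
  "triangle_part \<T> T S \<longleftrightarrow> T \<in> \<T> \<and> T \<subseteq> S \<and>
     (\<forall>v\<in>S - T. v \<notin> \<Union>\<T> \<and> neighbours E v \<subseteq> \<Union>\<T> \<and> neighbours E v \<inter> T \<noteq> {})"

text \<open>Degree three limits a star part to \<open>s \<le> 4\<close> vertices. It has at least
  \<open>s - 1\<close> edges, and \<open>(s - 1) / s \<ge> 3 * s / 16\<close> for \<open>s\<close>
  from 2 to 4. Equality at \<open>s = 4\<close> is where the constant \<open>3 / 16\<close> comes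
  from.\<close>

lemma star_part_density:
  assumes "S \<subseteq> V" "star_part S" shows "subset_density E S \<ge> 3 / 16 * real (card S)"
proof -
  have fS: "finite S" using assms finite_V finite_subset by blast
  obtain c where c: "c \<in> S" "S - {c} \<subseteq> neighbours E c" using assms by (auto simp: star_part_def)
  have "card (S - {c}) \<le> 3"
    using card_mono[OF finite_neighbours c(2)] card_neighbours c assms by auto
  then have s: "card S \<le> 4" "card S \<ge> 2" using c fS assms by (auto simp: star_part_def)
  have "card ((\<lambda>u. {c, u}) ` (S - {c})) \<le> card (induced_edges E S)"
    by (rule card_mono[OF finite_induced]) (use c in \<open>auto simp: induced_edges_def neighbours_def\<close>)
  moreover have "card ((\<lambda>u. {c, u}) ` (S - {c})) = card (S - {c})"
    by (rule card_image) (auto simp: inj_on_def doubleton_eq_iff)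
  ultimately have "card S - 1 \<le> card (induced_edges E S)" using c fS by simp
  moreover have "card S = 2 \<or> card S = 3 \<or> card S = 4" using s by linarith
  ultimately show ?thesis by (auto simp: subset_density_def field_simps)
qed

text \<open>The three edges of \<open>T\<close>, together with one edge into \<open>T\<close> for
  each further vertex, are at least as many edges as vertices.\<close>

lemma triangle_part_density:
  assumes "S \<subseteq> V" "triangle_part \<T> T S" "triangle T"
  shows "subset_density E S \<ge> 1"
proof -
  have fS: "finite S" using assms finite_V finite_subset by blast
  have T: "T \<subseteq> S" "card T = 3" "clique E T" using assms by (auto simp: triangle_part_def triangle_def)
  obtain x y z where xyz: "T = {x, y, z}" "x \<noteq> y" "x \<noteq> z" "y \<noteq> z"
    using T(2) by (auto simp: card_3_iff)
  have "\<exists>u\<in>T. {v, u} \<in> E" if "v \<in> S - T" for v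
  proof -
    have "neighbours E v \<inter> T \<noteq> {}" using that assms(2) unfolding triangle_part_def by blast
    then show ?thesis by (auto simp: neighbours_def)
  qed
  then obtain f where f: "\<And>v. v \<in> S - T \<Longrightarrow> f v \<in> T \<and> {v, f v} \<in> E" by metis
  let ?A = "(\<lambda>v. {v, f v}) ` (S - T)" and ?B = "{{x, y}, {x, z}, {y, z}}"
  have "card ?A = card (S - T)"
  proof (rule card_image, rule inj_onI)
    fix v w assume v: "v \<in> S - T" and w: "w \<in> S - T" and eq: "{v, f v} = {w, f w}"
    \<comment> \<open>The two pairs cannot match crosswise: \<open>f w\<close> lies in
      \<open>T\<close> and \<open>v\<close> does not.\<close>
    have "f w \<noteq> v" using f[OF w] v by blast
    then show "v = w" using eq by (simp add: doubleton_eq_iff)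
  qed
  moreover have "{x, y} \<noteq> {x, z}" "{x, y} \<noteq> {y, z}" "{x, z} \<noteq> {y, z}"
    using xyz by (simp_all add: doubleton_eq_iff)
  then have "card ?B = 3" by simp
  moreover have "?A \<inter> ?B = {}"
  proof -
    have "e \<subseteq> T" if "e \<in> ?B" for e using that xyz(1) by blast
    moreover have "\<not> e \<subseteq> T" if "e \<in> ?A" for e using that by blast
    ultimately show ?thesis by blast
  qed
  then have "card (?A \<union> ?B) = card ?A + card ?B" using fS by (intro card_Un_disjoint) auto
  moreover have "card (?A \<union> ?B) \<le> card (induced_edges E S)"
  proof (rule card_mono[OF finite_induced])
    have "?A \<subseteq> induced_edges E S" using f T by (auto simp: induced_edges_def)
    moreover have "?B \<subseteq> induced_edges E S"
      using T xyz by (auto simp: induced_edges_def clique_def)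
    ultimately show "?A \<union> ?B \<subseteq> induced_edges E S" by (rule Un_least)
  qed
  moreover have "card (S - T) = card S - 3" "card S \<ge> 3"
    using T fS card_mono[of S T] finite_subset[of T S] by (auto simp: card_Diff_subset)
  ultimately show ?thesis by (simp add: subset_density_def)
qed

lemma K4_density:
  assumes "card S = 4" "clique E S" shows "subset_density E S \<ge> 3 / 2"
proof -
  have fS: "finite S" using assms(1) card.infinite by fastforce
  have "{e. e \<subseteq> S \<and> card e = 2} \<subseteq> induced_edges E S"
    using assms(2) by (auto simp: clique_def induced_edges_def card_2_iff)
  then have "card {e. e \<subseteq> S \<and> card e = 2} \<le> card (induced_edges E S)"
    by (intro card_mono finite_induced)
  then have "6 \<le> card (induced_edges E S)" using n_subsets[OF fS, of 2] assms choose_2_small by simp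
  then show ?thesis using assms by (simp add: subset_density_def)
qed

text \<open>The three neighbours inside \<open>S\<close> already exhaust the degree of
  \<open>v\<close>, so a \<open>K4\<close> is a connected component.\<close>

lemma K4_neighbours:
  assumes "card S = 4" "clique E S" "v \<in> S" shows "neighbours E v = S - {v}" "S \<subseteq> V"
proof -
  have fS: "finite S" using assms(1) card.infinite by fastforce
  have sub: "S - {v} \<subseteq> neighbours E v" using assms by (auto simp: clique_def neighbours_def)
  have "card (S - {v}) = 3" using assms fS by simp
  then have "S - {v} \<noteq> {}" by (metis card.empty zero_neq_numeral)
  then obtain u where "u \<in> S - {v}" by blast
  then have vV: "v \<in> V" using assms edge_endpoints(1)[of v u] by (auto simp: clique_def)
  show "neighbours E v = S - {v}"
    using card_subset_eq[OF finite_neighbours sub] card_neighbours[OF vV] \<open>card (S - {v}) = 3\<close> by simp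
  then show "S \<subseteq> V" using neighbours_subset vV by blast
qed

end

section \<open>Partitions from triangle packings\<close>

text \<open>The packing is maximal under inclusion, not necessarily of maximum size; this is what a
  greedy choice delivers.\<close>

locale triangle_packing = cubic +
  fixes \<T> :: "'a set set"
  assumes triangles: "\<And>T. T \<in> \<T> \<Longrightarrow> triangle T"
    and disjoint_triangles: "disjoint \<T>"
    and maximal: "\<And>T. triangle T \<Longrightarrow> T \<inter> \<Union>\<T> \<noteq> {}"
begin

lemma triangles_subset: "\<Union>\<T> \<subseteq> V"
  using triangles by (auto simp: triangle_def)

lemma finite_triangles: "finite \<T>"
  using triangles_subset finite_V by (meson finite_UnionD finite_subset)

lemma triangle_unique: "v \<in> T \<Longrightarrow> v \<in> T' \<Longrightarrow> T \<in> \<T> \<Longrightarrow> T' \<in> \<T> \<Longrightarrow> T = T'"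
  using disjointD[OF disjoint_triangles] by blast

definition isolated :: "'a set" where
  "isolated = {v \<in> V. v \<notin> \<Union>\<T> \<and> neighbours E v \<subseteq> \<Union>\<T>}"

text \<open>Each vertex of a packed triangle has at most one neighbour outside the packing.\<close>

lemma card_isolated_le: "card isolated \<le> card \<T>"
proof -
  have fin: "finite isolated" using finite_V by (simp add: isolated_def)
  have disj: "neighbours E v \<inter> neighbours E w = {}"
    if v: "v \<in> isolated" and w: "w \<in> isolated" and "v \<noteq> w" for v w
  proof (rule ccontr)
    assume "\<not> ?thesis"
    then obtain x where x: "x \<in> neighbours E v" "x \<in> neighbours E w" by blast
    then obtain T where T: "T \<in> \<T>" "x \<in> T" using v unfolding isolated_def by blast
    have vw: "v \<notin> T" "w \<notin> T" using v w T by (auto simp: isolated_def)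
    have "T - {x} \<subseteq> neighbours E x" using triangle_member_neighbours triangles T by blast
    moreover have "v \<in> neighbours E x" "w \<in> neighbours E x" using x neighbours_sym by blast+
    ultimately have "card ({v, w} \<union> (T - {x})) \<le> card (neighbours E x)"
      by (intro card_mono finite_neighbours) blast
    also have "\<dots> = 3" using card_neighbours T triangles_subset by blast
    also have "card ({v, w} \<union> (T - {x})) = 2 + card (T - {x})"
      using vw \<open>v \<noteq> w\<close> finite_triangle[OF triangles] T by (subst card_Un_disjoint) auto
    also have "card (T - {x}) = 2"
      using triangles[OF T(1)] finite_triangle T by (simp add: triangle_def)
    finally show False by simp
  qed
  \<comment> \<open>The neighbourhoods of isolated vertices are pairwise disjoint triples inside the
    at most \<open>3 * card \<T>\<close> packed vertices.\<close>
  have "3 * card isolated = (\<Sum>v\<in>isolated. card (neighbours E v))"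
    using card_neighbours by (simp add: isolated_def)
  also have "\<dots> = card (\<Union>v\<in>isolated. neighbours E v)"
    using fin disj finite_neighbours by (intro card_UN_disjoint[symmetric]) auto
  also have "\<dots> \<le> card (\<Union>\<T>)"
    by (rule card_mono) (use triangles_subset finite_V finite_subset in \<open>auto simp: isolated_def\<close>)
  also have "\<dots> \<le> (\<Sum>T\<in>\<T>. card T)" by (rule card_Union_le_sum_card)
  also have "\<dots> = 3 * card \<T>" using triangles by (simp add: triangle_def)
  finally show ?thesis by simp
qed

text \<open>Keeping stars away from the packing forces every good part that meets a packed triangle
  to be a triangle part.\<close>

definition good_part :: "'a set \<Rightarrow> bool" where
  "good_part S \<longleftrightarrow> (star_part S \<and> S \<inter> \<Union>\<T> = {}) \<or> (\<exists>T. triangle_part \<T> T S)"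

text \<open>The part around a vertex of \<open>T\<close> meets the packing, so it is grown from some
  packed \<open>T'\<close>. That vertex cannot be one of the attached ones, so it lies in
  \<open>T'\<close>, and disjointness gives \<open>T' = T\<close>. With
  \<open>triangle_part_inj\<close> this provides at least \<open>card \<T>\<close> triangle
  parts.\<close>

lemma triangle_part_of_member:
  assumes Q: "partition_on V Q" "\<And>S. S \<in> Q \<Longrightarrow> good_part S" and T: "T \<in> \<T>"
  shows "\<exists>S\<in>Q. triangle_part \<T> T S"
proof -
  have "T \<noteq> {}" using triangles[OF T] by (auto simp: triangle_def)
  then obtain v where v: "v \<in> T" by blast
  then have "v \<in> \<Union>Q" using Q(1) triangles_subset T by (auto simp: partition_on_def)
  then obtain S where S: "S \<in> Q" "v \<in> S" by blast
  have "\<not> S \<inter> \<Union>\<T> = {}" using S v T by blast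
  then obtain T' where T': "triangle_part \<T> T' S" using Q(2)[OF S(1)] by (auto simp: good_part_def)
  have "v \<in> T'"
  proof (rule ccontr)
    assume "v \<notin> T'"
    then have "v \<in> S - T'" using S by blast
    then have "v \<notin> \<Union>\<T>" using T' unfolding triangle_part_def by blast
    then show False using v T by blast
  qed
  then have "T' = T" using triangle_unique v T T' unfolding triangle_part_def by blast
  then show ?thesis using S T' by blast
qed

lemma triangle_part_inj:
  assumes "triangle_part \<T> T S" "triangle_part \<T> T' S" shows "T = T'"
proof -
  have T: "T \<in> \<T>" "T' \<in> \<T>" "T' \<subseteq> S" "\<And>v. v \<in> S - T \<Longrightarrow> v \<notin> \<Union>\<T>"
    using assms unfolding triangle_part_def by blast+
  have "T' \<noteq> {}" using triangles[OF T(2)] by (auto simp: triangle_def)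
  then obtain v where v: "v \<in> T'" by blast
  then have "v \<in> T" using T by blast
  then show ?thesis using triangle_unique v T by blast
qed

text \<open>By maximality and because \<open>K\<close> is a component, some packed triangle
  \<open>T\<close> lies inside \<open>K\<close>; the fourth vertex \<open>x\<close> has exactly
  \<open>T\<close> as neighbourhood. A star around \<open>x\<close> would contain a packed vertex,
  so the part of \<open>x\<close> is grown from \<open>T\<close>, and no vertex outside
  \<open>K\<close> is adjacent to \<open>T\<close>. Hence each \<open>K4\<close> in a competing
  partition also earns its bonus in \<open>Q\<close>.\<close>

lemma K4_is_part:
  assumes Q: "partition_on V Q" "\<And>S. S \<in> Q \<Longrightarrow> good_part S"
    and K: "card K = 4" "clique E K"
  shows "K \<in> Q" "\<exists>T. triangle_part \<T> T K"
proof -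
  have N: "neighbours E v = K - {v}" if "v \<in> K" for v using K4_neighbours(1)[OF K that] .
  have fK: "finite K" using K(1) card.infinite by fastforce
  have KV: "K \<subseteq> V" using K4_neighbours(2)[OF K] K by fastforce
  have meet: "T \<subseteq> K" if "T \<in> \<T>" "v \<in> T" "v \<in> K" for T v
    using triangle_member_neighbours[OF triangles[OF that(1)] that(2)] N that by blast
  obtain T0 where T0: "T0 \<subseteq> K" "card T0 = 3" using K obtain_subset_with_card_n[of 3 K] by auto
  have "triangle T0" using T0 K KV by (auto simp: triangle_def clique_def)
  then obtain v T where v: "v \<in> T0" "T \<in> \<T>" "v \<in> T" using maximal by blast
  then have TK: "T \<subseteq> K" using meet T0 by blast
  have cT: "card T = 3" using triangles[OF v(2)] by (simp add: triangle_def)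
  have "card (K - T) = 1" using K cT TK fK by (simp add: card_Diff_subset finite_subset)
  then obtain x where x: "K - T = {x}" by (auto simp: card_1_singleton_iff)
  then have xK: "x \<in> K" "x \<notin> T" by blast+
  \<comment> \<open>A second packed triangle in \<open>K\<close> would be disjoint from
    \<open>T\<close> and have to fit into the single vertex \<open>x\<close>.\<close>
  have xT: "x \<notin> \<Union>\<T>"
  proof
    assume "x \<in> \<Union>\<T>"
    then obtain T' where T': "T' \<in> \<T>" "x \<in> T'" by blast
    then have "T' \<subseteq> K" using meet xK by blast
    moreover have "T' \<inter> T = {}" using triangle_unique T' v xK by blast
    ultimately have "T' \<subseteq> {x}" using x by blast
    then have "card T' \<le> 1" using card_mono[of "{x}" T'] by simp
    then show False using triangles[OF T'(1)] by (simp add: triangle_def)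
  qed
  have Nx: "neighbours E x = T" using N[OF xK(1)] x xK TK by blast
  have "x \<in> \<Union>Q" using Q(1) KV xK by (auto simp: partition_on_def)
  then obtain S where S: "S \<in> Q" "x \<in> S" by blast
  have "\<exists>T'. triangle_part \<T> T' S"
  proof (rule ccontr)
    assume "\<not> ?thesis"
    then have star: "star_part S" "S \<inter> \<Union>\<T> = {}" using Q(2)[OF S(1)] by (auto simp: good_part_def)
    then obtain c where c: "c \<in> S" "S - {c} \<subseteq> neighbours E c" "card S \<ge> 2"
      by (auto simp: star_part_def)
    have "\<exists>y\<in>S. y \<in> neighbours E x"
    proof (cases "x = c")
      case True
      have "S \<noteq> {x}" using c(3) by auto
      then show ?thesis using c True by blast
    next
      case False
      then have "x \<in> neighbours E c" using c S by blast
      then show ?thesis using c neighbours_sym by blast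
    qed
    then show False using star(2) Nx v by blast
  qed
  then obtain T' where T': "triangle_part \<T> T' S" by blast
  have T'T: "T' \<in> \<T>" "T' \<subseteq> S" and out: "\<And>v. v \<in> S - T' \<Longrightarrow> neighbours E v \<inter> T' \<noteq> {}"
    using T' unfolding triangle_part_def by blast+
  have "T' = T"
  proof -
    have "x \<in> S - T'" using S xT T'T by blast
    then show ?thesis using out Nx triangle_unique T'T v by blast
  qed
  have "S = K"
  proof
    have "K \<subseteq> insert x T" using x by blast
    then show "K \<subseteq> S" using S(2) T'T(2) \<open>T' = T\<close> by blast
    show "S \<subseteq> K"
    proof
      fix y assume "y \<in> S"
      show "y \<in> K"
      proof (cases "y \<in> T")
        case False
        then obtain u where u: "u \<in> neighbours E y" "u \<in> T" using out \<open>y \<in> S\<close> \<open>T' = T\<close> by blast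
        then have "y \<in> neighbours E u" using neighbours_sym by blast
        then show ?thesis using N u TK by blast
      qed (use TK in blast)
    qed
  qed
  then show "K \<in> Q" "\<exists>T. triangle_part \<T> T K" using S T' by auto
qed

text \<open>With \<open>\<kappa>\<close> the number of \<open>K4\<close> parts of \<open>P\<close>,
  the lower bound for \<open>Q\<close> is \<open>3 * n / 16 + \<tau> / 4 + \<kappa> / 2\<close>. Its
  multiple by \<open>4 / 3\<close> is \<open>n / 4 + \<tau> / 3 + 2 * \<kappa> / 3\<close>, which
  dominates the upper bound \<open>(n + \<tau> + \<kappa>) / 4\<close>.\<close>

theorem good_partition:
  assumes Q: "partition_on V Q" "\<And>S. S \<in> Q \<Longrightarrow> good_part S"
  shows "partition_on V P \<Longrightarrow> partition_density E P \<le> 4 / 3 * partition_density E Q"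
    and "0 < partition_density E Q"
proof -
  define \<tau> n where "\<tau> = real (card \<T>)" and "n = real (card V)"
  define Q2 where "Q2 = {S \<in> Q. \<exists>T. triangle_part \<T> T S}"
  have fQ: "finite Q" using finite_partition Q(1) .
  have Q2: "Q2 \<subseteq> Q" "finite Q2" using fQ by (auto simp: Q2_def)
  have sub: "S \<subseteq> V" if "S \<in> Q" for S using that Q(1) by (auto simp: partition_on_def)
  have cardQ2: "\<tau> \<le> real (card Q2)"
  proof -
    have "\<forall>T\<in>\<T>. \<exists>S. S \<in> Q \<and> triangle_part \<T> T S" using triangle_part_of_member[OF Q] by blast
    then obtain g where g: "\<And>T. T \<in> \<T> \<Longrightarrow> g T \<in> Q \<and> triangle_part \<T> T (g T)" by metis
    have "inj_on g \<T>" using g triangle_part_inj by (metis inj_onI)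
    moreover have "g ` \<T> \<subseteq> Q2" using g by (auto simp: Q2_def)
    ultimately show ?thesis using Q2 card_inj_on_le by (auto simp: \<tau>_def)
  qed
  \<comment> \<open>Triangle parts contain only packed vertices, at most \<open>3 * \<tau>\<close>,
    and isolated ones, at most \<open>\<tau>\<close>. So at least \<open>n - 4 * \<tau>\<close>
    vertices remain for the stars.\<close>
  have sizeQ2: "(\<Sum>S\<in>Q2. real (card S)) \<le> 4 * \<tau>"
  proof -
    have "(\<Sum>S\<in>Q2. card S) = card (\<Union>Q2)"
    proof (rule card_Union_disjoint[symmetric])
      show "pairwise disjnt Q2"
        using partition_onD2[OF Q(1)] Q2(1) by (meson pairwise_subset)
      show "finite S" if "S \<in> Q2" for S using that sub Q2 finite_V finite_subset by blast
    qed
    also have "\<dots> \<le> card (\<Union>\<T> \<union> isolated)"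
    proof (rule card_mono)
      show "finite (\<Union>\<T> \<union> isolated)"
        using triangles_subset finite_V finite_subset[of "\<Union>\<T>" V] by (auto simp: isolated_def)
      show "\<Union>Q2 \<subseteq> \<Union>\<T> \<union> isolated"
      proof
        fix v assume "v \<in> \<Union>Q2"
        then obtain S T where S: "v \<in> S" "S \<in> Q" "triangle_part \<T> T S" by (auto simp: Q2_def)
        then have "v \<in> V" using sub by blast
        then show "v \<in> \<Union>\<T> \<union> isolated"
          using S unfolding triangle_part_def isolated_def by blast
      qed
    qed
    also have "\<dots> \<le> card (\<Union>\<T>) + card isolated" by (rule card_Un_le)
    also have "card (\<Union>\<T>) \<le> (\<Sum>T\<in>\<T>. card T)" by (rule card_Union_le_sum_card)
    also have "(\<Sum>T\<in>\<T>. card T) = 3 * card \<T>" using triangles by (simp add: triangle_def)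
    finally have "(\<Sum>S\<in>Q2. card S) \<le> 4 * card \<T>" using card_isolated_le by linarith
    then have "real (\<Sum>S\<in>Q2. card S) \<le> real (4 * card \<T>)" by (simp only: of_nat_le_iff)
    then show ?thesis by (simp add: \<tau>_def)
  qed
  have stars: "(\<Sum>S\<in>Q - Q2. subset_density E S) \<ge> 3 / 16 * (n - 4 * \<tau>)"
  proof -
    have "n = (\<Sum>S\<in>Q - Q2. real (card S)) + (\<Sum>S\<in>Q2. real (card S))"
      using sum_card_partition[OF Q(1)] sum.subset_diff[OF Q2(1) fQ, of "\<lambda>S. real (card S)"]
      by (simp add: n_def)
    then have "3 / 16 * (n - 4 * \<tau>) \<le> 3 / 16 * (\<Sum>S\<in>Q - Q2. real (card S))" using sizeQ2 by simp
    also have "\<dots> = (\<Sum>S\<in>Q - Q2. 3 / 16 * real (card S))" by (rule sum_distrib_left)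
    also have "\<dots> \<le> (\<Sum>S\<in>Q - Q2. subset_density E S)"
    proof (rule sum_mono)
      fix S assume "S \<in> Q - Q2"
      then have "S \<in> Q" "star_part S" using Q(2) by (auto simp: good_part_def Q2_def)
      then show "3 / 16 * real (card S) \<le> subset_density E S" using star_part_density sub by blast
    qed
    finally show ?thesis .
  qed
  \<comment> \<open>\<open>K\<close> stays free: the empty set yields positivity, the
    \<open>K4\<close> parts of \<open>P\<close> yield the comparison.\<close>
  have lower: "partition_density E Q \<ge> \<tau> + real (card K) / 2 + 3 / 16 * (n - 4 * \<tau>)"
    if K: "K \<subseteq> {S. card S = 4 \<and> clique E S}" for K
  proof -
    have KQ: "K \<subseteq> Q2"
      using K4_is_part[OF Q] K unfolding Q2_def by blast
    have "\<tau> + real (card K) / 2 \<le> (\<Sum>S\<in>Q2. 1 + (if S \<in> K then 1 / 2 else 0))"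
      using cardQ2 Q2(2) KQ by (simp add: sum.distrib sum.If_cases Int_absorb1)
    also have "\<dots> \<le> (\<Sum>S\<in>Q2. subset_density E S)"
    proof (rule sum_mono)
      fix S assume "S \<in> Q2"
      then obtain T where S: "S \<in> Q" "triangle_part \<T> T S" by (auto simp: Q2_def)
      then have "triangle T" using triangles by (simp add: triangle_part_def)
      then have "subset_density E S \<ge> 1" by (rule triangle_part_density[OF sub[OF S(1)] S(2)])
      moreover have "subset_density E S \<ge> 3 / 2" if "S \<in> K"
        using K4_density that K by blast
      ultimately show "1 + (if S \<in> K then 1 / 2 else 0) \<le> subset_density E S" by simp
    qed
    finally show ?thesis
      using stars sum.subset_diff[OF Q2(1) fQ, of "subset_density E"]
      unfolding partition_density_def by linarith
  qed
  have n: "n > 0" using finite_V V_nonempty by (simp add: n_def card_gt_0_iff)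
  have \<tau>: "\<tau> \<ge> 0" by (simp add: \<tau>_def)
  show "0 < partition_density E Q"
    using lower[OF empty_subsetI] n \<tau> unfolding card.empty of_nat_0 by argo
  assume P: "partition_on V P"
  define K where "K = {S \<in> P. card S = 4 \<and> clique E S}"
  define D where "D = {S \<in> P. \<exists>T\<subseteq>S. triangle T}"
  have "card D \<le> card \<T>"
    unfolding D_def by (rule card_disjoint_triangles_le[OF finite_triangles triangles maximal P])
  then have "real (card D) \<le> \<tau>" by (simp add: \<tau>_def)
  moreover have "partition_density E P \<le> (n + real (card D) + real (card K)) / 4"
    using partition_density_le[OF P] by (simp only: K_def n_def D_def)
  moreover have "partition_density E Q \<ge> \<tau> + real (card K) / 2 + 3 / 16 * (n - 4 * \<tau>)"
    by (rule lower) (auto simp: K_def)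
  moreover have "real (card K) \<ge> 0" by simp
  ultimately show "partition_density E P \<le> 4 / 3 * partition_density E Q" using \<tau> by argo
qed

end

section \<open>Labellings\<close>

locale labelled_cubic = cubic "{..<n}" E for n :: nat and E :: "nat set set"
begin

text \<open>Label \<open>0\<close> means unlabelled, \<open>Suc (n + c)\<close> a part grown from a packed triangle containing
  \<open>c\<close>, and \<open>Suc c\<close> a star with centre \<open>c\<close>.\<close>

definition triangle_labels :: "nat set set \<Rightarrow> (nat \<Rightarrow> nat) \<Rightarrow> bool" where
  "triangle_labels \<T> lab \<longleftrightarrow> (\<forall>T\<in>\<T>. \<exists>c\<in>T. \<forall>v\<in>T. lab v = Suc (n + c))"

definition packing_labels :: "nat set set \<Rightarrow> (nat \<Rightarrow> nat) \<Rightarrow> bool" where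
  "packing_labels \<T> lab \<longleftrightarrow> (\<forall>T\<in>\<T>. triangle T) \<and> disjoint \<T> \<and> triangle_labels \<T> lab \<and>
     (\<forall>v\<in>{..<n} - \<Union>\<T>. lab v = 0)"

text \<open>The witness \<open>u\<close> rules out stars on a single vertex, whose density would be
  0. The centre carries its own label, so stars with different centres have different
  labels.\<close>

definition star_vertex :: "nat set set \<Rightarrow> (nat \<Rightarrow> nat) \<Rightarrow> nat \<Rightarrow> bool" where
  "star_vertex \<T> lab v \<longleftrightarrow> (\<exists>c\<in>{..<n} - \<Union>\<T>. lab v = Suc c \<and> lab c = Suc c \<and>
     (v = c \<or> {c, v} \<in> E) \<and> (\<exists>u\<in>{..<n} - \<Union>\<T>. u \<noteq> v \<and> lab u = Suc c))"

definition star_labels :: "nat set set \<Rightarrow> (nat \<Rightarrow> nat) \<Rightarrow> bool" where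
  "star_labels \<T> lab \<longleftrightarrow> triangle_labels \<T> lab \<and>
     (\<forall>v\<in>{..<n} - \<Union>\<T>. lab v = 0 \<or> star_vertex \<T> lab v)"

text \<open>Label \<open>0\<close> is still allowed, so this can be the invariant of the attaching
  loop; once all labels are nonzero, the label classes are good parts.\<close>

definition attached_labels :: "nat set set \<Rightarrow> (nat \<Rightarrow> nat) \<Rightarrow> bool" where
  "attached_labels \<T> lab \<longleftrightarrow> triangle_labels \<T> lab \<and>
     (\<forall>v\<in>{..<n} - \<Union>\<T>. star_vertex \<T> lab v \<or>
        neighbours E v \<subseteq> \<Union>\<T> \<and> (lab v = 0 \<or> (\<exists>u\<in>neighbours E v. lab v = lab u)))"

text \<open>With \<open>star_vertex_label\<close> this separates the label ranges: a single
  comparison with \<open>n\<close> tells packed vertices from star vertices.\<close>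

lemma triangle_label_gt: "triangle_labels \<T> lab \<Longrightarrow> v \<in> \<Union>\<T> \<Longrightarrow> n < lab v"
  by (fastforce simp: triangle_labels_def)

lemma star_vertex_label: "star_vertex \<T> lab v \<Longrightarrow> 0 < lab v \<and> lab v \<le> n"
  by (auto simp: star_vertex_def)

text \<open>Packed vertices have nonzero labels, so a triangle labelled \<open>0\<close> throughout
  is disjoint from the packing.\<close>

lemma packing_labels_insert:
  assumes pack: "packing_labels \<T> lab" and T: "triangle T" "c \<in> T" and "\<forall>v\<in>T. lab v = 0"
  shows "packing_labels (insert T \<T>) (\<lambda>v. if v \<in> T then Suc (n + c) else lab v)"
proof -
  have disj: "T \<inter> \<Union>\<T> = {}"
  proof (rule ccontr)
    assume "\<not> ?thesis"
    then obtain v where "v \<in> T" "v \<in> \<Union>\<T>" by blast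
    then show False using triangle_label_gt[of \<T> lab v] pack assms(4)
      by (auto simp: packing_labels_def)
  qed
  have "disjoint (insert T \<T>)"
    using pack disj unfolding packing_labels_def disjoint_def by blast
  moreover have "triangle_labels (insert T \<T>) (\<lambda>v. if v \<in> T then Suc (n + c) else lab v)"
    unfolding triangle_labels_def
  proof
    fix T' assume T': "T' \<in> insert T \<T>"
    show "\<exists>c'\<in>T'. \<forall>v\<in>T'. (if v \<in> T then Suc (n + c) else lab v) = Suc (n + c')"
    proof (cases "T' = T")
      case True
      then show ?thesis using T by auto
    next
      case False
      then have "T' \<in> \<T>" "T \<inter> T' = {}" using T' disj by auto
      then obtain c' where c': "c' \<in> T'" "\<forall>v\<in>T'. lab v = Suc (n + c')"
        using pack unfolding packing_labels_def triangle_labels_def by blast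
      show ?thesis
        using c' \<open>T \<inter> T' = {}\<close> by (intro bexI[OF _ c'(1)]) auto
    qed
  qed
  ultimately show ?thesis using pack T by (auto simp: packing_labels_def)
qed

lemma packing_labels_meets:
  assumes "packing_labels \<T> lab" "triangle T" "\<not> (\<forall>v\<in>T. lab v = 0)"
  shows "T \<inter> \<Union>\<T> \<noteq> {}"
  using assms unfolding packing_labels_def triangle_def by blast

lemma packing_labels_imp_star_labels: "packing_labels \<T> lab \<Longrightarrow> star_labels \<T> lab"
  by (auto simp: packing_labels_def star_labels_def)

text \<open>Label \<open>Suc c\<close> names the centre \<open>c\<close>, so
  \<open>Suc w \<noteq> lab b\<close> excludes the centre from the search for another leaf in the
  star of \<open>b\<close>.\<close>

definition last_leaf :: "nat \<Rightarrow> (nat \<Rightarrow> nat) \<Rightarrow> bool" where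
  "last_leaf b lab \<longleftrightarrow> \<not> (\<exists>w<n. w \<noteq> b \<and> Suc w \<noteq> lab b \<and> lab w = lab b)"

text \<open>An unlabelled vertex \<open>a\<close> joins its neighbour \<open>b\<close>, which becomes a centre; if this leaves
  the old centre of \<open>b\<close> alone, the old centre joins \<open>b\<close> as well.\<close>

definition join :: "nat \<Rightarrow> nat \<Rightarrow> (nat \<Rightarrow> nat) \<Rightarrow> nat \<Rightarrow> nat" where
  "join a b lab = (\<lambda>v. if v = a \<or> v = b \<or> 0 < lab b \<and> Suc v = lab b \<and>
       last_leaf b lab then Suc b else lab v)"

lemma star_labelsD:
  assumes "star_labels \<T> lab" "v \<in> {..<n} - \<Union>\<T>" "lab v \<noteq> 0" shows "star_vertex \<T> lab v"
proof -
  have "\<forall>v\<in>{..<n} - \<Union>\<T>. lab v = 0 \<or> star_vertex \<T> lab v"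
    using assms(1) unfolding star_labels_def by (rule conjunct2)
  from bspec[OF this assms(2)] show ?thesis using assms(3) by simp
qed

text \<open>The unlabelled \<open>a\<close> belongs to no star, so an old star can lose only
  \<open>b\<close>. If it keeps another leaf it is still a star; otherwise its centre is adjacent to
  \<open>b\<close> and moves along. Vertices that already had \<open>b\<close> as their centre keep
  their label.\<close>

lemma join_star_labels:
  assumes star: "star_labels \<T> lab" and ab: "{a, b} \<in> E" "a \<notin> \<Union>\<T>" "b \<notin> \<Union>\<T>" and a0: "lab a = 0"
  shows "star_labels \<T> (join a b lab)"
proof -
  let ?R = "{..<n} - \<Union>\<T>" and ?lab = "join a b lab"
  have R: "a \<in> ?R" "b \<in> ?R" and "a \<noteq> b" using ab edge_endpoints[OF ab(1)] by auto
  have tri: "triangle_labels \<T> lab" using star by (simp add: star_labels_def)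
  have centre: "c \<in> ?R" "lab c = Suc c" "v = c \<or> {c, v} \<in> E" if "v \<in> ?R" "lab v = Suc c" for v c
    using star_labelsD[OF star, of v] that by (auto simp: star_vertex_def)
  have la: "?lab a = Suc b" "?lab b = Suc b" by (simp_all add: join_def)
  have tri': "triangle_labels \<T> ?lab"
  proof -
    \<comment> \<open>The old centre of \<open>b\<close> lies outside the packing, so labels of
      packed vertices do not change.\<close>
    have "?lab v = lab v" if "v \<in> \<Union>\<T>" for v
    proof -
      have "Suc v \<noteq> lab b" if "lab b > 0" using centre(1)[of b v] R \<open>v \<in> \<Union>\<T>\<close> by auto
      then show ?thesis using that ab by (auto simp: join_def)
    qed
    then show ?thesis using tri unfolding triangle_labels_def by (metis UnionI)
  qed
  have "?lab v = 0 \<or> star_vertex \<T> ?lab v" if v: "v \<in> ?R" for v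
  proof -
    have bstar: "star_vertex \<T> ?lab v" if "?lab v = Suc b" "v = b \<or> {b, v} \<in> E"
    proof -
      have "\<exists>u\<in>?R. u \<noteq> v \<and> ?lab u = Suc b" using R la \<open>a \<noteq> b\<close> by metis
      with that la show ?thesis unfolding star_vertex_def by (intro bexI[OF _ R(2)]) blast
    qed
    show ?thesis
    proof (cases "?lab v = Suc b")
      case True
      have "v = b \<or> {b, v} \<in> E"
      proof (cases "v = a \<or> v = b")
        case True
        then show ?thesis using ab by (auto simp: insert_commute)
      next
        case False
        \<comment> \<open>Either \<open>v\<close> is the old centre of \<open>b\<close>, or
          \<open>b\<close> was already the centre of \<open>v\<close>; both give the edge between
          them.\<close>
        then have "lab b = Suc v \<or> lab v = Suc b" using True by (auto simp: join_def split: if_splits)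
        then show ?thesis
          using centre(3)[OF R(2), of v] centre(3)[OF v, of b] by (metis insert_commute)
      qed
      then show ?thesis using bstar True by simp
    next
      case False
      then have v': "?lab v = lab v" "v \<noteq> a" "v \<noteq> b" by (auto simp: join_def)
      show ?thesis
      proof (cases "lab v")
        case (Suc d)
        have d: "d \<in> ?R" "lab d = Suc d" "v = d \<or> {d, v} \<in> E" using centre[OF v Suc] by auto
        have "d \<noteq> b" using False v' Suc by auto
        have "d \<noteq> a" using d a0 by auto
        have vn: "v < n" using v by simp
        \<comment> \<open>If \<open>b\<close> was in the star of \<open>d\<close>, then
          \<open>v\<close> is either another leaf of it, or its centre, which kept its label and
          hence was not left alone.\<close>
        have other: "\<not> last_leaf b lab" if "lab b = Suc d"
        proof (cases "v = d")
          case True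
          then show ?thesis using False that v' by (auto simp: join_def split: if_splits)
        next
          case False
          then show ?thesis using that vn v' Suc by (auto simp: last_leaf_def)
        qed
        have ld: "?lab d = Suc d" using d \<open>d \<noteq> a\<close> \<open>d \<noteq> b\<close> other by (auto simp: join_def)
        have "\<exists>u\<in>?R. u \<noteq> v \<and> ?lab u = Suc d"
        proof (cases "v = d")
          case False
          then show ?thesis using ld by (intro bexI[OF _ d(1)]) auto
        next
          case True
          obtain u where u: "u \<in> ?R" "u \<noteq> v" "lab u = Suc d"
            using star_labelsD[OF star v] Suc unfolding star_vertex_def by auto
          \<comment> \<open>A leaf \<open>w\<close> of \<open>d\<close> is nobody's centre, since
            centres carry their own label; so it is not the vertex moved along with
            \<open>b\<close>.\<close>
          have keep: "?lab w = lab w" if "w \<noteq> b" "lab w = Suc d" "w \<noteq> d" "w \<in> ?R" for w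
          proof -
            have "Suc w \<noteq> lab b" using centre(2)[of b w] R that by auto
            then show ?thesis using that a0 by (auto simp: join_def)
          qed
          show ?thesis
          proof (cases "u = b")
            case False
            then show ?thesis using keep[of u] u True by auto
          next
            \<comment> \<open>The witness \<open>u\<close> was \<open>b\<close> itself, which leaves
              the star; a further leaf \<open>w\<close> replaces it.\<close>
            case True
            then obtain w where w: "w < n" "w \<noteq> b" "Suc w \<noteq> lab b" "lab w = lab b"
              using other u by (auto simp: last_leaf_def)
            have "w \<notin> \<Union>\<T>" using triangle_label_gt[OF tri, of w] w u True d(1) by auto
            then show ?thesis using keep[of w] w u True \<open>v = d\<close> by auto
          qed
        qed
        then show ?thesis unfolding star_vertex_def using d ld v' Suc by auto
      qed (use v' in simp)
    qed
  qed
  then show ?thesis using tri' by (simp add: star_labels_def)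
qed

lemma join_nonzero: "lab v \<noteq> 0 \<or> v = a \<or> v = b \<Longrightarrow> join a b lab v \<noteq> 0"
  by (auto simp: join_def)

text \<open>Once all edges outside the packing have labelled ends, an unlabelled vertex outside it
  can have only packed neighbours.\<close>

lemma star_labels_imp_attached_labels:
  assumes star: "star_labels \<T> lab"
    and covered: "\<And>u v. {u, v} \<in> E \<Longrightarrow> u \<notin> \<Union>\<T> \<Longrightarrow> v \<notin> \<Union>\<T> \<Longrightarrow> lab u \<noteq> 0"
  shows "attached_labels \<T> lab"
  unfolding attached_labels_def
proof (intro conjI ballI)
  fix v assume v: "v \<in> {..<n} - \<Union>\<T>"
  show "star_vertex \<T> lab v \<or> neighbours E v \<subseteq> \<Union>\<T> \<and> (lab v = 0 \<or> (\<exists>u\<in>neighbours E v. lab v = lab u))"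
  proof (cases "lab v = 0")
    case True
    then show ?thesis using covered[of v] v by (auto simp: neighbours_def)
  qed (use star_labelsD[OF star v] in simp)
qed (use star in \<open>simp add: star_labels_def\<close>)

text \<open>An unlabelled vertex is isolated, so its neighbour \<open>b\<close> is packed and has a
  nonzero label. Star vertices and their witnesses have nonzero labels, so changing the label of
  \<open>a\<close> does not touch them.\<close>

lemma attach:
  assumes att: "attached_labels \<T> lab" and ab: "{a, b} \<in> E" and a0: "lab a = 0"
  shows "attached_labels \<T> (lab(a := lab b))" "lab b \<noteq> 0"
proof -
  let ?lab = "lab(a := lab b)"
  have tri: "triangle_labels \<T> lab" using att by (simp add: attached_labels_def)
  have aT: "a \<notin> \<Union>\<T>" using triangle_label_gt[OF tri] a0 by force
  have an: "a \<in> {..<n}" using edge_endpoints[OF ab] by simp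
  have ns: "\<not> star_vertex \<T> lab a" using star_vertex_label a0 by fastforce
  have Na: "neighbours E a \<subseteq> \<Union>\<T>" using att an aT ns by (auto simp: attached_labels_def)
  have bN: "b \<in> neighbours E a" using ab by (simp add: neighbours_def)
  then show "lab b \<noteq> 0" using triangle_label_gt[OF tri] Na by fastforce
  have "triangle_labels \<T> ?lab"
    unfolding triangle_labels_def
  proof
    fix T assume T: "T \<in> \<T>"
    then obtain c where "c \<in> T" "\<forall>v\<in>T. lab v = Suc (n + c)" using tri by (auto simp: triangle_labels_def)
    then show "\<exists>c\<in>T. \<forall>v\<in>T. ?lab v = Suc (n + c)" using T aT by (intro bexI[of _ c]) auto
  qed
  moreover have "star_vertex \<T> ?lab v \<or> neighbours E v \<subseteq> \<Union>\<T> \<and>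
      (?lab v = 0 \<or> (\<exists>u\<in>neighbours E v. ?lab v = ?lab u))" if v: "v \<in> {..<n} - \<Union>\<T>" for v
  proof (cases "v = a")
    case True
    have "b \<noteq> a" using edge_endpoints(3)[OF ab] by simp
    then show ?thesis using True Na bN by auto
  next
    case False
    show ?thesis
    proof (cases "star_vertex \<T> lab v")
      case True
      then obtain c u where c: "c \<in> {..<n} - \<Union>\<T>" "lab v = Suc c" "lab c = Suc c"
        "v = c \<or> {c, v} \<in> E" "u \<in> {..<n} - \<Union>\<T>" "u \<noteq> v" "lab u = Suc c"
        unfolding star_vertex_def by blast
      have "u \<noteq> a" "c \<noteq> a" using c a0 by auto
      then have "star_vertex \<T> ?lab v" unfolding star_vertex_def
        using c False by (intro bexI[of _ c] conjI bexI[of _ u]) auto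
      then show ?thesis ..
    next
      case nstar: False
      then have N: "neighbours E v \<subseteq> \<Union>\<T>" "lab v = 0 \<or> (\<exists>u\<in>neighbours E v. lab v = lab u)"
        using att v by (auto simp: attached_labels_def)
      have "u \<noteq> a" if "u \<in> neighbours E v" for u using that N aT by blast
      then show ?thesis using N False by auto
    qed
  qed
  ultimately show "attached_labels \<T> ?lab" by (simp add: attached_labels_def)
qed

text \<open>Each label class is a good part: a label up to \<open>n\<close> gives a star part, a
  larger one a part grown from a packed triangle. Then \<open>good_partition\<close>
  applies.\<close>

theorem attached_labels_approximation:
  assumes pack: "\<And>T. T \<in> \<T> \<Longrightarrow> triangle T" "disjoint \<T>" "\<And>T. triangle T \<Longrightarrow> T \<inter> \<Union>\<T> \<noteq> {}"
    and att: "attached_labels \<T> lab" and covered: "\<And>v. v < n \<Longrightarrow> lab v \<noteq> 0"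
  defines "Q \<equiv> (\<lambda>v. {u \<in> {..<n}. lab u = lab v}) ` {..<n}"
  shows "partition_on {..<n} Q" "0 < partition_density E Q"
    "partition_on {..<n} P \<Longrightarrow> partition_density E P \<le> 4 / 3 * partition_density E Q"
proof -
  interpret triangle_packing "{..<n}" E \<T>
    by unfold_locales (use pack in auto)
  have tri: "triangle_labels \<T> lab" using att by (simp add: attached_labels_def)
  show Q: "partition_on {..<n} Q"
    unfolding Q_def by (rule partition_onI) (auto simp: disjnt_def)
  have good: "good_part S" if SQ: "S \<in> Q" for S
  proof -
    obtain v where v: "v < n" "S = {u \<in> {..<n}. lab u = lab v}"
      using SQ by (auto simp: Q_def)
    have attD: "star_vertex \<T> lab u \<or> neighbours E u \<subseteq> \<Union>\<T> \<and> (\<exists>w\<in>neighbours E u. lab u = lab w)"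
      if "u < n" "u \<notin> \<Union>\<T>" for u
    proof -
      have "\<forall>v\<in>{..<n} - \<Union>\<T>. star_vertex \<T> lab v \<or>
        neighbours E v \<subseteq> \<Union>\<T> \<and> (lab v = 0 \<or> (\<exists>u\<in>neighbours E v. lab v = lab u))"
        using att unfolding attached_labels_def by (rule conjunct2)
      from bspec[OF this, of u] show ?thesis using that covered[of u] by simp
    qed
    show ?thesis
    proof (cases "lab v \<le> n")
      case True
      have notT: "u \<notin> \<Union>\<T>" if "u \<in> S" for u
        using triangle_label_gt[OF tri, of u] that v True by auto
      \<comment> \<open>Any other vertex would carry the label of a packed neighbour, which exceeds
        \<open>n\<close>.\<close>
      have star: "star_vertex \<T> lab u" if uS: "u \<in> S" for u
      proof (rule ccontr)
        assume ns: "\<not> ?thesis"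
        have "u < n" "u \<notin> \<Union>\<T>" using uS v notT by auto
        from attD[OF this] ns obtain w where "w \<in> \<Union>\<T>" "lab u = lab w" by blast
        then show False using triangle_label_gt[OF tri, of w] uS v True by auto
      qed
      have vS: "v \<in> S" using v by simp
      obtain c u where c: "c < n" "lab v = Suc c" "lab c = Suc c" and u: "u < n" "u \<noteq> v" "lab u = Suc c"
        using star[OF vS] by (auto simp: star_vertex_def)
      have "card {u, v} \<le> card S" by (rule card_mono) (use u c v in auto)
      then have "2 \<le> card S" using u by simp
      moreover have "S - {c} \<subseteq> neighbours E c"
      proof
        fix w assume w: "w \<in> S - {c}"
        then have "lab w = Suc c" using v c by simp
        then show "w \<in> neighbours E c" using star[of w] w by (auto simp: star_vertex_def neighbours_def)
      qed
      moreover have "c \<in> S" using c v by simp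
      ultimately have "star_part S" by (auto simp: star_part_def)
      then show ?thesis using notT by (auto simp: good_part_def)
    next
      case False
      then have nostar: "\<not> star_vertex \<T> lab u" if "u \<in> S" for u
        using star_vertex_label[of \<T> lab u] that v by auto
      have "\<exists>x\<in>\<Union>\<T>. lab x = lab v"
      proof (cases "v \<in> \<Union>\<T>")
        case nT: False
        have "v \<in> S" using v by simp
        then have "\<not> star_vertex \<T> lab v" by (rule nostar)
        then obtain w where "w \<in> neighbours E v" "neighbours E v \<subseteq> \<Union>\<T>" "lab v = lab w"
          using attD[OF v(1) nT] by blast
        then show ?thesis by (intro bexI[of _ w]) auto
      qed blast
      then obtain x T where x: "x \<in> T" "T \<in> \<T>" "lab x = lab v" by blast
      \<comment> \<open>Two packed triangles with equal labels share the vertex \<open>c\<close>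
        named by the label, so disjointness makes them equal.\<close>
      have same: "y \<in> T \<longleftrightarrow> lab y = lab v" if y: "y \<in> \<Union>\<T>" for y
      proof -
        obtain T' where T': "y \<in> T'" "T' \<in> \<T>" using y by blast
        obtain c where c: "c \<in> T" "\<forall>v\<in>T. lab v = Suc (n + c)"
          using tri x unfolding triangle_labels_def by blast
        obtain c' where c': "c' \<in> T'" "\<forall>v\<in>T'. lab v = Suc (n + c')"
          using tri T' unfolding triangle_labels_def by blast
        show ?thesis
        proof
          show "y \<in> T \<Longrightarrow> lab y = lab v" using c x by simp
          assume "lab y = lab v"
          then have "c = c'" using c c' x T' by simp
          then have "T = T'" using triangle_unique c c' x T' by blast
          then show "y \<in> T" using T' by simp
        qed
      qed
      have "triangle_part \<T> T S"
        unfolding triangle_part_def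
      proof (intro conjI ballI)
        have "T \<subseteq> {..<n}" using triangles_subset x by blast
        then show "T \<subseteq> S" using same x v by auto
        fix u assume u: "u \<in> S - T"
        then have lu: "u < n" "lab u = lab v" using v by auto
        show uT: "u \<notin> \<Union>\<T>" using same[of u] u lu by blast
        have N: "neighbours E u \<subseteq> \<Union>\<T>" "\<exists>w\<in>neighbours E u. lab u = lab w"
          using attD[OF lu(1) uT] nostar[of u] u by blast+
        then show "neighbours E u \<subseteq> \<Union>\<T>" by simp
        from N obtain w where w: "w \<in> neighbours E u" "lab u = lab w" by blast
        then have "w \<in> T" using same[of w] N(1) lu by auto
        then show "neighbours E u \<inter> T \<noteq> {}" using w by blast
      qed (use x in simp)
      then show ?thesis by (auto simp: good_part_def)
    qed
  qed
  show "0 < partition_density E Q" using good_partition(2)[OF Q good] .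
  show "partition_on {..<n} P \<Longrightarrow> partition_density E P \<le> 4 / 3 * partition_density E Q"
    using good_partition(1)[OF Q good] .
qed

end

section \<open>Running time of structured programs\<close>

text \<open>A bound on the running time, valid if every loop makes at most \<open>B\<close> iterations.\<close>

fun cost_bound :: "nat \<Rightarrow> com \<Rightarrow> nat" where
  "cost_bound B Skip = 1"
| "cost_bound B (SetReg x a) = acost a + 1"
| "cost_bound B (SetMem a b) = acost a + acost b + 1"
| "cost_bound B (Seq c d) = cost_bound B c + cost_bound B d"
| "cost_bound B (Cond b c d) = bcost b + (cost_bound B c + cost_bound B d)"
| "cost_bound B (While b c) = bcost b + B * (bcost b + cost_bound B c)"

lemma cost_bound_polynomial: "\<exists>p. \<forall>B. cost_bound B c = poly p B"
proof (induction c)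
  case (Seq c d)
  then obtain p q where "\<forall>B. cost_bound B c = poly p B" "\<forall>B. cost_bound B d = poly q B" by blast
  then show ?case by (intro exI[of _ "p + q"]) simp
next
  case (Cond b c d)
  then obtain p q where "\<forall>B. cost_bound B c = poly p B" "\<forall>B. cost_bound B d = poly q B" by blast
  then show ?case by (intro exI[of _ "[:bcost b:] + (p + q)"]) simp
next
  case (While b c)
  then obtain p where "\<forall>B. cost_bound B c = poly p B" by blast
  \<comment> \<open>\<open>pCons\<close> adds a constant and multiplies the rest by
    \<open>B\<close>, which is the cost of a loop; the degree grows with the nesting depth.\<close>
  then show ?case by (intro exI[of _ "pCons (bcost b) ([:bcost b:] + p)"]) simp
next
  case Skip
  show ?case by (intro exI[of _ 1]) simp
next
  case (SetReg x a)
  show ?case by (intro exI[of _ "[:acost a + 1:]"]) simp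
next
  case (SetMem a b)
  show ?case by (intro exI[of _ "[:acost a + acost b + 1:]"]) simp
qed

section \<open>Total correctness with a time bound\<close>

definition runs :: "nat \<Rightarrow> com \<Rightarrow> state \<Rightarrow> (state \<Rightarrow> bool) \<Rightarrow> bool" where
  "runs B c s Q \<longleftrightarrow> (\<exists>t s'. exec c s t s' \<and> t \<le> cost_bound B c \<and> Q s')"

lemma runs_Seq:
  assumes "runs B c s R" "\<And>s'. R s' \<Longrightarrow> runs B d s' Q"
  shows "runs B (Seq c d) s Q"
proof -
  obtain t s' where c: "exec c s t s'" "t \<le> cost_bound B c" "R s'"
    using assms(1) by (auto simp: runs_def)
  obtain u s'' where "exec d s' u s''" "u \<le> cost_bound B d" "Q s''"
    using assms(2)[OF c(3)] by (auto simp: runs_def)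
  with c show ?thesis
    unfolding runs_def by (intro exI[of _ "t + u"] exI[of _ s'']) (auto intro: exec.Seq)
qed

lemma runs_Cond:
  assumes "bval b s \<Longrightarrow> runs B c s Q" "\<not> bval b s \<Longrightarrow> runs B d s Q"
  shows "runs B (Cond b c d) s Q"
proof (cases "bval b s")
  case True
  then obtain t s' where "exec c s t s'" "t \<le> cost_bound B c" "Q s'"
    using assms(1) by (auto simp: runs_def)
  with True show ?thesis
    unfolding runs_def by (intro exI[of _ "bcost b + t"] exI[of _ s']) (auto intro: exec.CondTrue)
next
  case False
  then obtain t s' where "exec d s t s'" "t \<le> cost_bound B d" "Q s'"
    using assms(2) by (auto simp: runs_def)
  with False show ?thesis
    unfolding runs_def by (intro exI[of _ "bcost b + t"] exI[of _ s']) (auto intro: exec.CondFalse)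
qed

text \<open>The value of \<open>run\<close> on loops is irrelevant.\<close>

fun loop_free :: "com \<Rightarrow> bool" where
  "loop_free (Seq c d) \<longleftrightarrow> loop_free c \<and> loop_free d"
| "loop_free (Cond b c d) \<longleftrightarrow> loop_free c \<and> loop_free d"
| "loop_free (While b c) \<longleftrightarrow> False"
| "loop_free _ \<longleftrightarrow> True"

fun run :: "com \<Rightarrow> state \<Rightarrow> state" where
  "run Skip s = s"
| "run (SetReg x a) s = ((fst s)(x := aval a s), snd s)"
| "run (SetMem a b) s = (fst s, (snd s)(aval a s := aval b s))"
| "run (Seq c d) s = run d (run c s)"
| "run (Cond b c d) s = (if bval b s then run c s else run d s)"
| "run (While b c) s = s"

text \<open>Straight-line code is handled by evaluating \<open>run\<close>; its time is covered
  because \<open>cost_bound\<close> charges both branches of a conditional.\<close>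

lemma runs_loop_free: "loop_free c \<Longrightarrow> Q (run c s) \<Longrightarrow> runs B c s Q"
proof (induction c arbitrary: s Q)
  case (Seq c d)
  show ?case
    by (rule runs_Seq[where R = "\<lambda>s'. s' = run c s"]) (use Seq in auto)
next
  case (Cond b c d)
  then show ?case by (intro runs_Cond) auto
next
  case Skip
  then show ?case unfolding runs_def by (intro exI[of _ 1] exI[of _ s]) (use exec.Skip[of s] in simp)
next
  case (SetReg x a)
  obtain r m where "s = (r, m)" by (cases s)
  then show ?case using SetReg exec.SetReg[of x a r m]
    unfolding runs_def by (intro exI[of _ "acost a + 1"] exI[of _ "(r(x := aval a (r, m)), m)"]) simp
next
  case (SetMem a b)
  obtain r m where "s = (r, m)" by (cases s)
  then show ?case using SetMem exec.SetMem[of a b r m]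
    unfolding runs_def
    by (intro exI[of _ "acost a + acost b + 1"] exI[of _ "(r, m(aval a (r, m) := aval b (r, m)))"]) simp
qed auto

lemma runs_mono: "runs B c s R \<Longrightarrow> (\<And>s'. R s' \<Longrightarrow> Q s') \<Longrightarrow> runs B c s Q"
  unfolding runs_def by blast

lemma runs_Seq_loop_free:
  "loop_free c \<Longrightarrow> runs B d (run c s) Q \<Longrightarrow> runs B (Seq c d) s Q"
  by (rule runs_Seq[where R = "\<lambda>s'. s' = run c s"]) (auto intro: runs_loop_free)

definition For :: "nat \<Rightarrow> nat \<Rightarrow> com \<Rightarrow> com" where
  "For x y c = Seq (SetReg x (Num 0))
     (While (Less (Reg x) (Reg y)) (Seq c (SetReg x (Plus (Reg x) (Num 1)))))"

text \<open>The body must preserve the counter \<open>x\<close> and the limit \<open>y\<close>, so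
  there are exactly \<open>N\<close> iterations. The invariant is stated with the counter already
  advanced, as the next iteration finds it.\<close>

lemma runs_For:
  assumes N: "N = fst s y" "N \<le> B" "x \<noteq> y"
    and init: "I 0 ((fst s)(x := 0), snd s)"
    and step: "\<And>i r m. i < N \<Longrightarrow> I i (r, m) \<Longrightarrow> r x = i \<Longrightarrow> r y = N \<Longrightarrow>
      runs B c (r, m) (\<lambda>s. I (Suc i) ((fst s)(x := Suc i), snd s) \<and> fst s x = i \<and> fst s y = N)"
    and post: "\<And>s. I N s \<Longrightarrow> Q s"
  shows "runs B (For x y c) s Q"
proof -
  let ?b = "Less (Reg x) (Reg y)" and ?a = "Plus (Reg x) (Num 1)"
  let ?c = "Seq c (SetReg x ?a)"
  \<comment> \<open>Induction on the number \<open>k\<close> of iterations still to come.\<close>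
  have loop: "\<exists>t s'. exec (While ?b ?c) (r, m) t s' \<and> t \<le> bcost ?b + k * (bcost ?b + cost_bound B ?c) \<and> I N s'"
    if "I i (r, m)" "r x = i" "r y = N" "i + k = N" for k i r m
    using that
  proof (induction k arbitrary: i r m)
    case 0
    have "exec (While ?b ?c) (r, m) (bcost ?b) (r, m)"
      by (rule exec.WhileFalse) (use 0 in simp)
    then show ?case using 0 by (intro exI[of _ "bcost ?b"] exI[of _ "(r, m)"]) simp
  next
    case (Suc k)
    obtain t s where t: "exec c (r, m) t s" "t \<le> cost_bound B c"
      "I (Suc i) ((fst s)(x := Suc i), snd s)" "fst s x = i" "fst s y = N"
      using step[of i r m] Suc.prems by (auto simp: runs_def)
    obtain r' m' where s: "s = (r', m')" by (cases s)
    have body: "exec ?c (r, m) (t + (acost ?a + 1)) (r'(x := Suc i), m')"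
      using exec.Seq[OF t(1)[unfolded s] exec.SetReg[of x ?a r' m']] t s by (simp del: acost.simps)
    have next_inv: "I (Suc i) (r'(x := Suc i), m')" using t(3) unfolding s fst_conv snd_conv .
    have "\<exists>u s'. exec (While ?b ?c) (r'(x := Suc i), m') u s' \<and>
        u \<le> bcost ?b + k * (bcost ?b + cost_bound B ?c) \<and> I N s'"
      by (rule Suc.IH[OF next_inv]) (use t s Suc.prems N(3) in auto)
    then obtain u s' where u: "exec (While ?b ?c) (r'(x := Suc i), m') u s'"
      "u \<le> bcost ?b + k * (bcost ?b + cost_bound B ?c)" "I N s'" by blast
    have "exec (While ?b ?c) (r, m) (bcost ?b + (t + (acost ?a + 1)) + u) s'"
      by (rule exec.WhileTrue[OF _ body u(1)]) (use Suc.prems in auto)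
    then show ?case using u t by (intro exI[of _ "bcost ?b + (t + (acost ?a + 1)) + u"] exI[of _ s']) auto
  qed
  obtain r m where s: "s = (r, m)" by (cases s)
  have "\<exists>t s'. exec (While ?b ?c) (r(x := 0), m) t s' \<and>
      t \<le> bcost ?b + N * (bcost ?b + cost_bound B ?c) \<and> I N s'"
    by (rule loop[of 0 "r(x := 0)" m]) (use init N s in simp_all)
  then obtain t s' where t: "exec (While ?b ?c) (r(x := 0), m) t s'"
    "t \<le> bcost ?b + N * (bcost ?b + cost_bound B ?c)" "I N s'" by blast
  have "exec (For x y c) s (acost (Num 0) + 1 + t) s'"
    unfolding For_def s using exec.Seq[OF exec.SetReg[of x "Num 0" r m] , of "While ?b ?c" t s'] t
    by (simp del: acost.simps)
  moreover have "acost (Num 0) + 1 + t \<le> cost_bound B (For x y c)"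
  proof -
    have "N * (bcost ?b + cost_bound B ?c) \<le> B * (bcost ?b + cost_bound B ?c)"
      by (rule mult_le_mono1) fact
    then show ?thesis using t(2) by (simp add: For_def del: mult_le_cancel2)
  qed
  ultimately show ?thesis using t(3) post unfolding runs_def by blast
qed

section \<open>The algorithm\<close>

text \<open>The absolute difference: one of the truncated differences is always 0. It makes equality
  expressible although \<open>Less\<close> is the only test.\<close>

definition dist_exp :: "aexp \<Rightarrow> aexp \<Rightarrow> aexp" where
  "dist_exp a b = Plus (Minus a b) (Minus b a)"

definition eq_exp :: "aexp \<Rightarrow> aexp \<Rightarrow> bexp" where
  "eq_exp a b = Less (dist_exp a b) (Num 1)"

lemma aval_dist_exp: "aval (dist_exp a b) s = 0 \<longleftrightarrow> aval a s = aval b s"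
  by (auto simp: dist_exp_def)

lemma bval_eq_exp [simp]: "bval (eq_exp a b) s \<longleftrightarrow> aval a s = aval b s"
  by (auto simp: eq_exp_def dist_exp_def)

text \<open>Registers 0, 1, 2 hold the number of vertices, the number of edges, and the address of
  the label table; 3, 4, 5 are loop counters; 6 and 7 hold the ends of the current edge,
  8 and 9 are flags, and 10 is scratch space.\<close>

definition tail_of :: "nat \<Rightarrow> aexp" where "tail_of x = Mem (Plus (Reg x) (Reg x))"
definition head_of :: "nat \<Rightarrow> aexp" where "head_of x = Mem (Plus (Plus (Reg x) (Reg x)) (Num 1))"
definition label_of :: "nat \<Rightarrow> aexp" where "label_of x = Mem (Plus (Reg 2) (Reg x))"
definition set_label :: "nat \<Rightarrow> aexp \<Rightarrow> com" where "set_label x a = SetMem (Plus (Reg 2) (Reg x)) a"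

definition load_edge :: com where
  "load_edge = Seq (SetReg 6 (tail_of 3)) (SetReg 7 (head_of 3))"

text \<open>A sum of two distances below 1 encodes the conjunction of two equalities; both
  orientations of the edge are tried.\<close>

definition probe :: "nat \<Rightarrow> nat \<Rightarrow> com" where
  "probe x f =
     Cond (Less (Plus (dist_exp (tail_of 5) (Reg x)) (dist_exp (head_of 5) (Reg 4))) (Num 1))
       (SetReg f (Num 1))
     (Cond (Less (Plus (dist_exp (tail_of 5) (Reg 4)) (dist_exp (head_of 5) (Reg x))) (Num 1))
       (SetReg f (Num 1)) Skip)"

definition find_adjacent :: com where
  "find_adjacent = Seq (SetReg 8 (Num 0)) (Seq (SetReg 9 (Num 0)) (For 5 1 (Seq (probe 6 8) (probe 7 9))))"

text \<open>Sums again encode conjunctions: both flags are set if they exceed 1 together, and the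
  three labels vanish if their sum is below 1. The first end of the edge serves as the name of the
  triangle.\<close>

definition mark_triangle :: com where
  "mark_triangle =
     (let l = Plus (Num 1) (Plus (Reg 0) (Reg 6)) in
      Cond (Less (Num 1) (Plus (Reg 8) (Reg 9)))
        (Cond (Less (Plus (label_of 6) (Plus (label_of 7) (label_of 4))) (Num 1))
          (Seq (set_label 7 l) (Seq (set_label 4 l) (set_label 6 l))) Skip) Skip)"

definition pack_triangles :: com where
  "pack_triangles = For 3 1 (Seq load_edge (For 4 0 (Seq find_adjacent mark_triangle)))"

definition probe_leaf :: com where
  "probe_leaf = Cond (eq_exp (Reg 4) (Reg 7)) Skip
     (Cond (eq_exp (Plus (Reg 4) (Num 1)) (Reg 10)) Skip
     (Cond (eq_exp (label_of 4) (Reg 10)) (SetReg 8 (Num 1)) Skip))"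

text \<open>Register 10 holds the old label \<open>Suc c\<close> of \<open>b\<close>, hence the
  subtraction of 1 in the address of the label of the old centre \<open>c\<close>.\<close>

definition relabel :: com where
  "relabel = Seq
     (Cond (Less (Num 0) (Reg 10))
       (Cond (Less (Reg 8) (Num 1)) (SetMem (Minus (Plus (Reg 2) (Reg 10)) (Num 1)) (Plus (Reg 7) (Num 1))) Skip)
       Skip)
     (Seq (set_label 7 (Plus (Reg 7) (Num 1))) (set_label 6 (Plus (Reg 7) (Num 1))))"

definition join_star :: com where
  "join_star = Seq (SetReg 10 (label_of 7)) (Seq (SetReg 8 (Num 0)) (Seq (For 4 0 probe_leaf) relabel))"

text \<open>A swap that brings an unlabelled end, if there is one, into register 6.\<close>

definition unlabelled_first :: com where
  "unlabelled_first = Cond (eq_exp (label_of 6) (Num 0)) Skip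
     (Seq (SetReg 10 (Reg 6)) (Seq (SetReg 6 (Reg 7)) (SetReg 7 (Reg 10))))"

definition build_stars :: com where
  "build_stars = For 3 1 (Seq load_edge
     (Cond (Less (Reg 0) (label_of 6)) Skip
     (Cond (Less (Reg 0) (label_of 7)) Skip
       (Seq unlabelled_first (Cond (eq_exp (label_of 6) (Num 0)) join_star Skip)))))"

definition attach_isolated :: com where
  "attach_isolated = For 3 1 (Seq load_edge (Seq
     (Cond (eq_exp (label_of 6) (Num 0)) (set_label 6 (label_of 7)) Skip)
     (Cond (eq_exp (label_of 7) (Num 0)) (set_label 7 (label_of 6)) Skip)))"

definition copy_labels :: com where
  "copy_labels = For 4 0 (SetMem (Reg 4) (label_of 4))"

text \<open>The label table starts at address \<open>n + 2 * M\<close>, with \<open>M\<close> the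
  number of edges: behind the edge list and behind the output cells below \<open>n\<close>.\<close>

definition algorithm :: com where
  "algorithm = Seq (SetReg 2 (Plus (Reg 0) (Plus (Reg 1) (Reg 1))))
     (Seq pack_triangles (Seq build_stars (Seq attach_isolated copy_labels)))"

lemma ex_less_Suc: "(\<exists>k<Suc j. P k) \<longleftrightarrow> P j \<or> (\<exists>k<j. P k)"
  by (auto simp: less_Suc_eq)

locale encoded_cubic = labelled_cubic n E for n E +
  fixes es :: "(nat \<times> nat) list"
  assumes encodes: "encodes_graph n es {..<n} E"
begin

abbreviation "M \<equiv> length es"

section \<open>Memory layout and effect of the straight-line code\<close>

definition edge_at :: "nat \<Rightarrow> nat set" where "edge_at i = {fst (es ! i), snd (es ! i)}"

lemma edge_at: "i < M \<Longrightarrow> edge_at i \<in> E" and edge_at_surj: "e \<in> E \<Longrightarrow> \<exists>i<M. edge_at i = e"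
proof -
  have E: "E = (\<lambda>(u, v). {u, v}) ` set es" using encodes by (simp add: encodes_graph_def)
  show "i < M \<Longrightarrow> edge_at i \<in> E" unfolding E edge_at_def by (auto intro!: image_eqI[of _ _ "es ! i"] split: prod.split)
  show "e \<in> E \<Longrightarrow> \<exists>i<M. edge_at i = e" unfolding E edge_at_def
    by (auto simp: in_set_conv_nth) (metis fst_conv snd_conv)
qed

text \<open>Only registers 0 to 2, the edge list and the label table are fixed, so all counters and
  scratch registers may change freely.\<close>

definition holds :: "state \<Rightarrow> (nat \<Rightarrow> nat) \<Rightarrow> bool" where
  "holds s lab \<longleftrightarrow> fst s 0 = n \<and> fst s 1 = M \<and> fst s 2 = n + (M + M) \<and>
     (\<forall>i<M. snd s (i + i) = fst (es ! i) \<and> snd s (i + i + 1) = snd (es ! i)) \<and>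
     (\<forall>v<n. snd s (n + (M + M) + v) = lab v)"

lemma holds_regs: "holds s lab \<Longrightarrow> fst s 0 = n" "holds s lab \<Longrightarrow> fst s 1 = M"
  "holds s lab \<Longrightarrow> fst s (Suc 0) = M" "holds s lab \<Longrightarrow> fst s 2 = n + (M + M)"
  by (simp_all add: holds_def)

lemma holds_cong:
  "holds s lab \<Longrightarrow> snd s' = snd s \<Longrightarrow> fst s' 0 = fst s 0 \<Longrightarrow> fst s' 1 = fst s 1 \<Longrightarrow> fst s' 2 = fst s 2
    \<Longrightarrow> holds s' lab"
  by (simp add: holds_def)

lemma holds_set_label:
  assumes "holds (r, m) lab" "v < n"
  shows "holds (r, m(n + (M + M) + v := k)) (lab(v := k))"
  using assms by (auto simp: holds_def)

lemma aval_ends: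
  assumes "holds s lab" "fst s x = i" "i < M"
  shows "aval (tail_of x) s = fst (es ! i)" "aval (head_of x) s = snd (es ! i)"
  using assms by (simp_all add: holds_def tail_of_def head_of_def)

lemma aval_label_of: "holds s lab \<Longrightarrow> fst s x < n \<Longrightarrow> aval (label_of x) s = lab (fst s x)"
  by (simp add: holds_def label_of_def)

lemma holds_run_set_label:
  assumes "holds s lab" "fst s x < n"
  shows "holds (run (set_label x a) s) (lab(fst s x := aval a s))"
    "fst (run (set_label x a) s) = fst s"
  using holds_set_label[of "fst s" "snd s" lab "fst s x" "aval a s"] assms
  by (simp_all add: set_label_def holds_regs)

lemma run_load_edge:
  assumes "holds s lab" "fst s 3 = i" "i < M"
  shows "run load_edge s = ((fst s)(6 := fst (es ! i), 7 := snd (es ! i)), snd s)"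
proof -
  have "aval (head_of 3) ((fst s)(6 := k), snd s) = aval (head_of 3) s" for k
    by (simp add: head_of_def)
  then show ?thesis unfolding load_edge_def run.simps aval_ends(1)[OF assms] fst_conv snd_conv
    by (simp only: aval_ends(2)[OF assms])
qed

section \<open>The packing phase\<close>

lemma run_probe:
  assumes "holds s lab" "fst s 5 = j" "j < M"
  shows "run (probe x f) s = (if edge_at j = {fst s x, fst s 4} then ((fst s)(f := 1), snd s) else s)"
proof -
  have "bval (Less (Plus (dist_exp (tail_of 5) (Reg u)) (dist_exp (head_of 5) (Reg w))) (Num 1)) s
      \<longleftrightarrow> fst (es ! j) = fst s u \<and> snd (es ! j) = fst s w" for u w
    using aval_ends[OF assms] aval_dist_exp[of "tail_of 5" "Reg u" s] aval_dist_exp[of "head_of 5" "Reg w" s]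
    by simp
  then show ?thesis unfolding probe_def edge_at_def doubleton_eq_iff run.simps aval.simps
    by (simp only: split: if_splits) blast
qed

lemma runs_find_adjacent:
  assumes h: "holds s lab" and B: "M \<le> B"
  shows "runs B find_adjacent s (\<lambda>s'. snd s' = snd s \<and> (\<forall>x. x \<notin> {5, 8, 9} \<longrightarrow> fst s' x = fst s x) \<and>
    fst s' 8 = of_bool ({fst s 6, fst s 4} \<in> E) \<and> fst s' 9 = of_bool ({fst s 7, fst s 4} \<in> E))"
proof -
  let ?s = "((fst s)(8 := 0, 9 := 0), snd s)"
  let ?I = "\<lambda>j s'. snd s' = snd s \<and> (\<forall>x. x \<notin> {5, 8, 9} \<longrightarrow> fst s' x = fst s x) \<and>
    fst s' 8 = of_bool (\<exists>k<j. edge_at k = {fst s 6, fst s 4}) \<and>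
    fst s' 9 = of_bool (\<exists>k<j. edge_at k = {fst s 7, fst s 4})"
  have adj: "(\<exists>k<M. edge_at k = e) \<longleftrightarrow> e \<in> E" for e using edge_at edge_at_surj by blast
  have loop: "runs B (For 5 1 (Seq (probe 6 8) (probe 7 9))) ?s (\<lambda>s'. snd s' = snd s \<and>
    (\<forall>x. x \<notin> {5, 8, 9} \<longrightarrow> fst s' x = fst s x) \<and>
    fst s' 8 = of_bool ({fst s 6, fst s 4} \<in> E) \<and> fst s' 9 = of_bool ({fst s 7, fst s 4} \<in> E))"
  proof (rule runs_For[where I = ?I and N = M])
    fix j r m
    assume j: "j < M" and I: "?I j (r, m)" and r: "r 5 = j" "r 1 = M"
    have h1: "holds (r, m) lab" by (rule holds_cong[OF h]) (use I in auto)
    have J: "r 4 = fst s 4" "r 7 = fst s 7" using I by auto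
    have s1: "run (probe 6 8) (r, m) = (if edge_at j = {fst s 6, fst s 4} then (r(8 := 1), m) else (r, m))"
      using run_probe[OF h1, of j 6 8] j r I by simp
    have h2: "holds (run (probe 6 8) (r, m)) lab" by (rule holds_cong[OF h1]) (auto simp: s1)
    have regs: "fst (run (probe 6 8) (r, m)) 7 = fst s 7" "fst (run (probe 6 8) (r, m)) 4 = fst s 4"
      "fst (run (probe 6 8) (r, m)) 5 = j"
      using r by (simp_all add: s1 J)
    have "run (probe 7 9) (run (probe 6 8) (r, m)) =
      (if edge_at j = {fst s 7, fst s 4}
       then ((fst (run (probe 6 8) (r, m)))(9 := 1), snd (run (probe 6 8) (r, m))) else run (probe 6 8) (r, m))"
      using run_probe[OF h2 regs(3) j, of 7 9] unfolding regs .
    then have s2: "run (Seq (probe 6 8) (probe 7 9)) (r, m) =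
      (r(8 := (if edge_at j = {fst s 6, fst s 4} then 1 else r 8),
         9 := (if edge_at j = {fst s 7, fst s 4} then 1 else r 9)), m)"
      by (auto simp: s1 fun_eq_iff)
    show "runs B (Seq (probe 6 8) (probe 7 9)) (r, m)
        (\<lambda>s'. ?I (Suc j) ((fst s')(5 := Suc j), snd s') \<and> fst s' 5 = j \<and> fst s' 1 = M)"
    proof (rule runs_loop_free)
      show "loop_free (Seq (probe 6 8) (probe 7 9))" by (simp add: probe_def)
      show "?I (Suc j) ((fst (run (Seq (probe 6 8) (probe 7 9)) (r, m)))(5 := Suc j),
          snd (run (Seq (probe 6 8) (probe 7 9)) (r, m))) \<and>
        fst (run (Seq (probe 6 8) (probe 7 9)) (r, m)) 5 = j \<and>
        fst (run (Seq (probe 6 8) (probe 7 9)) (r, m)) 1 = M"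
        unfolding s2 ex_less_Suc using I r by simp
    qed
  qed (use h B adj in \<open>auto simp: holds_regs\<close>)
  show ?thesis unfolding find_adjacent_def
    by (rule runs_Seq_loop_free, simp, rule runs_Seq_loop_free, simp) (use loop in simp)
qed

lemma ends: assumes "i < M" shows "fst (es ! i) < n" "snd (es ! i) < n" "{fst (es ! i), snd (es ! i)} \<in> E"
  using edge_at[OF assms] edge_endpoints unfolding edge_at_def by auto

lemma run_mark_triangle:
  assumes h: "holds s lab" and ab: "fst s 6 = a" "fst s 7 = b" "fst s 4 = w" "a < n" "b < n" "w < n"
    and pq: "fst s 8 = of_bool p" "fst s 9 = of_bool q"
  shows "holds (run mark_triangle s) (if p \<and> q \<and> lab a = 0 \<and> lab b = 0 \<and> lab w = 0
      then (\<lambda>v. if v \<in> {a, b, w} then Suc (n + a) else lab v) else lab)"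
    "fst (run mark_triangle s) = fst s"
proof -
  define l where "l = Plus (Num 1) (Plus (Reg 0) (Reg 6))"
  define s1 where "s1 = run (set_label 7 l) s"
  define s2 where "s2 = run (set_label 4 l) s1"
  define s3 where "s3 = run (set_label 6 l) s2"
  have l: "aval l s' = Suc (n + a)" if "fst s' = fst s" for s'
    using that h ab by (simp add: l_def holds_regs)
  have 1: "fst s1 = fst s" "holds s1 (lab(b := Suc (n + a)))"
    using holds_run_set_label[OF h, of 7 l] ab l by (simp_all add: s1_def)
  have 2: "fst s2 = fst s" "holds s2 (lab(b := Suc (n + a), w := Suc (n + a)))"
    using holds_run_set_label[OF 1(2), of 4 l] ab l 1 by (simp_all add: s2_def)
  have 3: "fst s3 = fst s" "holds s3 (lab(b := Suc (n + a), w := Suc (n + a), a := Suc (n + a)))"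
    using holds_run_set_label[OF 2(2), of 6 l] ab l 2 by (simp_all add: s3_def)
  have "lab(b := Suc (n + a), w := Suc (n + a), a := Suc (n + a)) =
      (\<lambda>v. if v \<in> {a, b, w} then Suc (n + a) else lab v)"
    by (auto simp: fun_eq_iff)
  with 3(2) have 4: "holds s3 (\<lambda>v. if v \<in> {a, b, w} then Suc (n + a) else lab v)" by simp
  have lab: "aval (label_of 6) s = lab a" "aval (label_of 7) s = lab b" "aval (label_of 4) s = lab w"
    using aval_label_of[OF h] ab by auto
  have "run mark_triangle s = (if p \<and> q \<and> lab a = 0 \<and> lab b = 0 \<and> lab w = 0 then s3 else s)"
    by (simp add: mark_triangle_def Let_def lab pq s3_def s2_def s1_def l_def)
  then show "holds (run mark_triangle s) (if p \<and> q \<and> lab a = 0 \<and> lab b = 0 \<and> lab w = 0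
      then (\<lambda>v. if v \<in> {a, b, w} then Suc (n + a) else lab v) else lab)"
    "fst (run mark_triangle s) = fst s"
    using h 3(1) 4 by simp_all
qed

text \<open>The packing is a ghost variable, visible to the program only through labels. The
  counters describe two nested loops: edges before \<open>i\<close> are finished, edge
  \<open>i\<close> has been tried with third vertices below \<open>w\<close>.\<close>

definition packed_upto :: "nat \<Rightarrow> nat \<Rightarrow> state \<Rightarrow> bool" where
  "packed_upto i w s \<longleftrightarrow> (\<exists>\<T> lab. holds s lab \<and> packing_labels \<T> lab \<and>
     (\<forall>j<i. \<forall>T. triangle T \<and> edge_at j \<subseteq> T \<longrightarrow> T \<inter> \<Union>\<T> \<noteq> {}) \<and>
     (\<forall>v<w. triangle (insert v (edge_at i)) \<longrightarrow> insert v (edge_at i) \<inter> \<Union>\<T> \<noteq> {}))"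

lemma packed_upto_cong:
  assumes "packed_upto i w s" "snd s' = snd s" "fst s' 0 = fst s 0" "fst s' 1 = fst s 1" "fst s' 2 = fst s 2"
  shows "packed_upto i w s'"
  using assms(1) holds_cong[OF _ assms(2-5)] unfolding packed_upto_def by blast

lemma packed_upto_regs:
  assumes "packed_upto i w s" shows "fst s 0 = n" "fst s 1 = M"
  using assms by (auto simp: packed_upto_def holds_def)

text \<open>A triangle containing edge \<open>i\<close> is that edge plus one vertex below
  \<open>n\<close>, so the completed inner loop has met it.\<close>

lemma packed_upto_next:
  assumes p: "packed_upto i n s" and i: "i < M" shows "packed_upto (Suc i) 0 s"
proof -
  obtain \<T> lab where *: "holds s lab" "packing_labels \<T> lab"
    "\<And>j T. j < i \<Longrightarrow> triangle T \<Longrightarrow> edge_at j \<subseteq> T \<Longrightarrow> T \<inter> \<Union>\<T> \<noteq> {}"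
    "\<And>v. v < n \<Longrightarrow> triangle (insert v (edge_at i)) \<Longrightarrow> insert v (edge_at i) \<inter> \<Union>\<T> \<noteq> {}"
    using p unfolding packed_upto_def by blast
  have new: "T \<inter> \<Union>\<T> \<noteq> {}" if T: "triangle T" "edge_at i \<subseteq> T" for T
  proof -
    have c: "card (edge_at i) = 2" "card T = 3" "T \<subseteq> {..<n}"
      using edge(2)[OF edge_at[OF i]] T by (auto simp: triangle_def)
    have "card (T - edge_at i) = 1"
      using c T finite_triangle by (simp add: card_Diff_subset finite_edge[OF edge_at[OF i]])
    then obtain v where v: "T - edge_at i = {v}" by (auto simp: card_1_singleton_iff)
    then have "T = insert v (edge_at i)" "v < n" using T c by blast+
    then show ?thesis using *(4) T by metis
  qed
  have "T \<inter> \<Union>\<T> \<noteq> {}" if "j < Suc i" "triangle T" "edge_at j \<subseteq> T" for j T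
    using that new[of T] *(3)[of j T] by (cases "j = i") simp_all
  then show ?thesis using *(1,2) unfolding packed_upto_def by blast
qed

text \<open>For \<open>w = a\<close> or \<open>w = b\<close> both sides fail: the set has only two
  elements, and the right-hand side asks for a loop.\<close>

lemma triangle_edge_insert:
  assumes "{a, b} \<in> E" shows "triangle (insert w {a, b}) \<longleftrightarrow> {a, w} \<in> E \<and> {b, w} \<in> E"
proof
  assume T: "triangle (insert w {a, b})"
  then have "w \<noteq> a" "w \<noteq> b" using edge_endpoints[OF assms] by (auto simp: triangle_def insert_absorb)
  then show "{a, w} \<in> E \<and> {b, w} \<in> E" using T by (auto simp: triangle_def clique_def)
next
  assume w: "{a, w} \<in> E \<and> {b, w} \<in> E"
  have "a \<noteq> b" "a \<noteq> w" "b \<noteq> w" "a < n" "b < n" "w < n"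
    using edge_endpoints assms w by blast+
  then show "triangle (insert w {a, b})"
    using w assms by (auto simp: triangle_def clique_def insert_commute)
qed

text \<open>A triangle with all labels \<open>0\<close> joins the packing; any other triangle has a
  labelled vertex and so meets the packing already. The packing only grows, so earlier triangles
  still meet it.\<close>

lemma packed_upto_step:
  assumes p: "packed_upto i w s" and i: "i < M" and w: "w < n" "fst s 4 = w"
    and ab: "fst s 6 = fst (es ! i)" "fst s 7 = snd (es ! i)" and B: "M \<le> B"
  shows "runs B (Seq find_adjacent mark_triangle) s
    (\<lambda>s'. packed_upto i (Suc w) s' \<and> (\<forall>x\<in>{3, 4, 6, 7}. fst s' x = fst s x))"
proof -
  define a b where "a = fst (es ! i)" and "b = snd (es ! i)"
  have e: "edge_at i = {a, b}" by (simp add: edge_at_def a_def b_def)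
  have abn: "a < n" "b < n" "{a, b} \<in> E" using ends[OF i] by (simp_all add: a_def b_def)
  obtain \<T> lab where h: "holds s lab" and pack: "packing_labels \<T> lab"
    and old: "\<And>j T. j < i \<Longrightarrow> triangle T \<Longrightarrow> edge_at j \<subseteq> T \<Longrightarrow> T \<inter> \<Union>\<T> \<noteq> {}"
    "\<And>v. v < w \<Longrightarrow> triangle (insert v {a, b}) \<Longrightarrow> insert v {a, b} \<inter> \<Union>\<T> \<noteq> {}"
    using p unfolding packed_upto_def e by blast
  show ?thesis
  proof (rule runs_Seq[OF runs_find_adjacent[OF h B]], elim conjE)
    fix s' assume s': "snd s' = snd s" "\<forall>x. x \<notin> {5, 8, 9} \<longrightarrow> fst s' x = fst s x"
      and pq: "fst s' 8 = of_bool ({fst s 6, fst s 4} \<in> E)" "fst s' 9 = of_bool ({fst s 7, fst s 4} \<in> E)"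
    have h': "holds s' lab" by (rule holds_cong[OF h]) (use s' in auto)
    have r: "fst s' 6 = a" "fst s' 7 = b" "fst s' 4 = w" "fst s' 3 = fst s 3"
      using s'(2) ab w by (simp_all add: a_def b_def)
    have pq': "fst s' 8 = of_bool ({a, w} \<in> E)" "fst s' 9 = of_bool ({b, w} \<in> E)"
      using pq ab w by (simp_all add: a_def b_def)
    note mark = run_mark_triangle[OF h' r(1-3) abn(1,2) w(1) pq']
    let ?T = "insert w {a, b}"
    have regs: "\<forall>x\<in>{3, 4, 6, 7}. fst (run mark_triangle s') x = fst s x"
      unfolding mark(2) using s'(2) by simp
    have "packed_upto i (Suc w) (run mark_triangle s')"
    proof (cases "triangle ?T \<and> (\<forall>v\<in>?T. lab v = 0)")
      case True
      have adj: "{a, w} \<in> E \<and> {b, w} \<in> E \<and> lab a = 0 \<and> lab b = 0 \<and> lab w = 0"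
        using True triangle_edge_insert[OF abn(3)] by simp
      have "?T = {a, b, w}" by auto
      then have h2: "holds (run mark_triangle s') (\<lambda>v. if v \<in> ?T then Suc (n + a) else lab v)"
        using mark(1) unfolding if_P[OF adj] by simp
      have "packing_labels (insert ?T \<T>) (\<lambda>v. if v \<in> ?T then Suc (n + a) else lab v)"
        using True by (intro packing_labels_insert[OF pack]) auto
      moreover have "v < Suc w \<Longrightarrow> triangle (insert v {a, b}) \<Longrightarrow>
          insert v {a, b} \<inter> \<Union>(insert ?T \<T>) \<noteq> {}" for v
        by blast
      moreover have "j < i \<Longrightarrow> triangle T \<Longrightarrow> edge_at j \<subseteq> T \<Longrightarrow> T \<inter> \<Union>(insert ?T \<T>) \<noteq> {}" for j T
        using old(1)[of j T] by blast
      ultimately show ?thesis using h2 unfolding packed_upto_def e by blast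
    next
      case False
      then have "\<not> ({a, w} \<in> E \<and> {b, w} \<in> E \<and> lab a = 0 \<and> lab b = 0 \<and> lab w = 0)"
        using triangle_edge_insert[OF abn(3)] by auto
      then have h2: "holds (run mark_triangle s') lab" using mark(1) by (simp only: if_False)
      have "triangle ?T \<Longrightarrow> ?T \<inter> \<Union>\<T> \<noteq> {}"
        using packing_labels_meets[OF pack, of ?T] False by blast
      then have "v < Suc w \<Longrightarrow> triangle (insert v {a, b}) \<Longrightarrow> insert v {a, b} \<inter> \<Union>\<T> \<noteq> {}" for v
        using old(2)[of v] by (cases "v = w") simp_all
      then show ?thesis using h2 pack old(1) unfolding packed_upto_def e by blast
    qed
    then show "runs B mark_triangle s'
        (\<lambda>s'. packed_upto i (Suc w) s' \<and> (\<forall>x\<in>{3, 4, 6, 7}. fst s' x = fst s x))"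
      using regs
      by (intro runs_loop_free) (auto simp: mark_triangle_def set_label_def Let_def)
  qed
qed

lemma runs_pack_triangles:
  assumes h: "holds s (\<lambda>_. 0)" and B: "n + M \<le> B"
  shows "runs B pack_triangles s (\<lambda>s. packed_upto M 0 s)"
  unfolding pack_triangles_def
proof (rule runs_For[where I = "\<lambda>i. packed_upto i 0" and N = M])
  show "packed_upto 0 0 ((fst s)(3 := 0), snd s)"
  proof (rule packed_upto_cong)
    have "packing_labels {} (\<lambda>_. 0)"
      by (auto simp: packing_labels_def triangle_labels_def disjoint_def)
    then show "packed_upto 0 0 s" using h unfolding packed_upto_def by blast
  qed auto
  fix i r m
  assume i: "i < M" and p: "packed_upto i 0 (r, m)" and r: "r 3 = i" "r 1 = M"
  let ?s = "(r(6 := fst (es ! i), 7 := snd (es ! i)), m)"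
  let ?Q = "\<lambda>s. packed_upto (Suc i) 0 ((fst s)(3 := Suc i), snd s) \<and> fst s 3 = i \<and> fst s 1 = M"
  have p1: "packed_upto i 0 ?s" by (rule packed_upto_cong[OF p]) auto
  have load: "run load_edge (r, m) = ?s"
    using p run_load_edge[of "(r, m)" _ i] i r unfolding packed_upto_def by fastforce
  let ?I = "\<lambda>w s. packed_upto i w s \<and> fst s 3 = i \<and> fst s 6 = fst (es ! i) \<and> fst s 7 = snd (es ! i)"
  have "runs B (For 4 0 (Seq find_adjacent mark_triangle)) ?s ?Q"
  proof (rule runs_For[where I = ?I and N = n])
    show "?I 0 ((fst ?s)(4 := 0), snd ?s)"
      using packed_upto_cong[OF p1] r by simp
    show "n = fst ?s 0" using packed_upto_regs[OF p1] by simp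
    fix w r' m'
    assume w: "w < n" and I: "?I w (r', m')" and r': "r' 4 = w" "r' 0 = n"
    have st: "runs B (Seq find_adjacent mark_triangle) (r', m')
      (\<lambda>s'. packed_upto i (Suc w) s' \<and> (\<forall>x\<in>{3, 4, 6, 7}. fst s' x = fst (r', m') x))"
      by (rule packed_upto_step) (use I i w r' B in auto)
    show "runs B (Seq find_adjacent mark_triangle) (r', m')
        (\<lambda>s. ?I (Suc w) ((fst s)(4 := Suc w), snd s) \<and> fst s 4 = w \<and> fst s 0 = n)"
    proof (rule runs_mono[OF st])
      fix s' assume s': "packed_upto i (Suc w) s' \<and> (\<forall>x\<in>{3, 4, 6, 7}. fst s' x = fst (r', m') x)"
      then have p': "packed_upto i (Suc w) s'" by blast
      have "packed_upto i (Suc w) ((fst s')(4 := Suc w), snd s')"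
        by (rule packed_upto_cong[OF p']) simp_all
      then show "?I (Suc w) ((fst s')(4 := Suc w), snd s') \<and> fst s' 4 = w \<and> fst s' 0 = n"
        using conjunct2[OF s'] I r' packed_upto_regs(1)[OF p'] by simp
    qed
  next
    fix s assume I: "?I n s"
    then have p: "packed_upto (Suc i) 0 s" using packed_upto_next i by blast
    have "packed_upto (Suc i) 0 ((fst s)(3 := Suc i), snd s)"
      by (rule packed_upto_cong[OF p]) auto
    then show "?Q s" using I packed_upto_regs[OF p] by simp
  qed (use B in auto)
  then show "runs B (Seq load_edge (For 4 0 (Seq find_adjacent mark_triangle))) (r, m) ?Q"
    by (intro runs_Seq_loop_free) (simp_all only: load, simp add: load_edge_def)
qed (use h B in \<open>auto simp: holds_regs\<close>)

section \<open>The star phase\<close>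

lemma star_labels_gt:
  assumes "star_labels \<T> lab" "v < n" shows "n < lab v \<longleftrightarrow> v \<in> \<Union>\<T>"
proof
  show "v \<in> \<Union>\<T>" if "n < lab v"
  proof (rule ccontr)
    assume "v \<notin> \<Union>\<T>"
    then have "star_vertex \<T> lab v" using star_labelsD[OF assms(1), of v] assms(2) that by simp
    then show False using star_vertex_label that by fastforce
  qed
  show "v \<in> \<Union>\<T> \<Longrightarrow> n < lab v" using triangle_label_gt conjunct1[OF assms(1)[unfolded star_labels_def]] by blast
qed

lemma run_relabel:
  assumes h: "holds s lab" and ab: "fst s 6 = a" "fst s 7 = b" "a < n" "b < n"
    and c: "fst s 10 = lab b" "fst s 8 = of_bool (\<not> last_leaf b lab)" "lab b \<le> n"
  shows "holds (run relabel s) (join a b lab)" "fst (run relabel s) = fst s"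
proof -
  let ?b = "Plus (Reg 7) (Num 1)"
  define lab1 where "lab1 = (if 0 < lab b \<and> last_leaf b lab then lab(lab b - 1 := Suc b) else lab)"
  define s1 where "s1 = (if 0 < lab b \<and> last_leaf b lab
    then (fst s, (snd s)(n + (M + M) + (lab b - 1) := Suc b)) else s)"
  have h1: "holds s1 lab1" "fst s1 = fst s"
    using h holds_set_label[of "fst s" "snd s" lab "lab b - 1" "Suc b"] c(3)
    by (auto simp: s1_def lab1_def)
  define s2 where "s2 = run (set_label 7 ?b) s1"
  have h2: "holds s2 (lab1(b := Suc b))" "fst s2 = fst s"
    using holds_run_set_label[OF h1(1), of 7 ?b] h1(2) ab by (simp_all add: s2_def)
  define s3 where "s3 = run (set_label 6 ?b) s2"
  have h3: "holds s3 (lab1(b := Suc b, a := Suc b))" "fst s3 = fst s"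
    using holds_run_set_label[OF h2(1), of 6 ?b] h2(2) ab by (simp_all add: s3_def)
  have "run relabel s = s3"
  proof -
    \<comment> \<open>Truncated subtraction can be regrouped because \<open>lab b\<close> is
      positive, which the program tests first.\<close>
    have "fst s 2 + fst s 10 - 1 = n + (M + M) + (lab b - 1)" if "0 < lab b"
      using that h c(1) by (simp add: holds_regs)
    then show ?thesis using c(1,2) ab
      by (simp add: relabel_def s3_def s2_def s1_def)
  qed
  moreover have "lab1(b := Suc b, a := Suc b) = join a b lab"
    by (auto simp: fun_eq_iff join_def lab1_def)
  ultimately show "holds (run relabel s) (join a b lab)" "fst (run relabel s) = fst s"
    using h3 by simp_all
qed

lemma run_probe_leaf:
  assumes "holds s lab" "fst s 4 < n"
  shows "run probe_leaf s = (if fst s 4 \<noteq> fst s 7 \<and> Suc (fst s 4) \<noteq> fst s 10 \<and> lab (fst s 4) = fst s 10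
    then ((fst s)(8 := 1), snd s) else s)"
  using aval_label_of[OF assms] by (simp add: probe_leaf_def)

lemma runs_join_star:
  assumes h: "holds s lab" and ab: "fst s 6 = a" "fst s 7 = b" "a < n" "b < n"
    and c: "lab b \<le> n" and B: "n \<le> B"
  shows "runs B join_star s (\<lambda>s'. holds s' (join a b lab) \<and> fst s' 3 = fst s 3)"
proof -
  define s1 where "s1 = ((fst s)(10 := lab b, 8 := 0), snd s)"
  have h1: "holds s1 lab" by (rule holds_cong[OF h]) (simp_all add: s1_def)
  have lb: "aval (label_of 7) s = lab b" using aval_label_of[OF h] ab by auto
  let ?P = "\<lambda>k. k \<noteq> b \<and> Suc k \<noteq> lab b \<and> lab k = lab b"
  let ?I = "\<lambda>w s'. snd s' = snd s \<and> (\<forall>x. x \<notin> {4, 8} \<longrightarrow> fst s' x = fst s1 x) \<and>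
    fst s' 8 = of_bool (\<exists>k<w. ?P k)"
  have "runs B (For 4 0 probe_leaf) s1
    (\<lambda>s'. holds s' lab \<and> fst s' 3 = fst s 3 \<and> fst s' 6 = a \<and> fst s' 7 = b \<and>
      fst s' 10 = lab b \<and> fst s' 8 = of_bool (\<not> last_leaf b lab))"
  proof (rule runs_For[where I = ?I and N = n])
    fix w r m
    assume w: "w < n" and I: "?I w (r, m)" and r: "r 4 = w" "r 0 = n"
    have h2: "holds (r, m) lab" by (rule holds_cong[OF h1]) (use I in \<open>auto simp: s1_def\<close>)
    have J: "r 7 = b" "r 10 = lab b" using I ab by (simp_all add: s1_def)
    have step: "run probe_leaf (r, m) = (if ?P w then (r(8 := 1), m) else (r, m))"
      using run_probe_leaf[OF h2] w r J by simp
    show "runs B probe_leaf (r, m)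
        (\<lambda>s'. ?I (Suc w) ((fst s')(4 := Suc w), snd s') \<and> fst s' 4 = w \<and> fst s' 0 = n)"
      by (rule runs_loop_free, simp add: probe_leaf_def) (unfold step ex_less_Suc, use I r in simp)
  next
    show "?I 0 ((fst s1)(4 := 0), snd s1)" by (simp add: s1_def)
    fix s' assume I: "?I n s'"
    have "holds s' lab" by (rule holds_cong[OF h1]) (use I in \<open>auto simp: s1_def\<close>)
    then show "holds s' lab \<and> fst s' 3 = fst s 3 \<and> fst s' 6 = a \<and> fst s' 7 = b \<and>
      fst s' 10 = lab b \<and> fst s' 8 = of_bool (\<not> last_leaf b lab)"
      using I ab by (simp add: s1_def last_leaf_def)
  qed (use h1 B in \<open>auto simp: holds_regs\<close>)
  then have "runs B (Seq (For 4 0 probe_leaf) relabel) s1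
      (\<lambda>s'. holds s' (join a b lab) \<and> fst s' 3 = fst s 3)"
  proof (rule runs_Seq, elim conjE)
    fix s' assume s': "holds s' lab" "fst s' 3 = fst s 3" "fst s' 6 = a" "fst s' 7 = b"
      "fst s' 10 = lab b" "fst s' 8 = of_bool (\<not> last_leaf b lab)"
    show "runs B relabel s' (\<lambda>s'. holds s' (join a b lab) \<and> fst s' 3 = fst s 3)"
      using run_relabel[OF s'(1,3,4) ab(3,4) s'(5,6) c] s'(2)
      by (intro runs_loop_free) (simp_all add: relabel_def set_label_def)
  qed
  note tail = this
  show ?thesis unfolding join_star_def
    by (rule runs_Seq_loop_free, simp, rule runs_Seq_loop_free, simp) (use tail in \<open>simp add: lb s1_def\<close>)
qed

text \<open>The packing is a parameter here because it is final. Only edges that avoid it have to be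
  covered; \<open>join_nonzero\<close> keeps covered ones covered.\<close>

definition starred_upto :: "nat set set \<Rightarrow> nat \<Rightarrow> state \<Rightarrow> bool" where
  "starred_upto \<T> i s \<longleftrightarrow> (\<exists>lab. holds s lab \<and> star_labels \<T> lab \<and>
     (\<forall>j<i. edge_at j \<inter> \<Union>\<T> = {} \<longrightarrow> (\<forall>v\<in>edge_at j. lab v \<noteq> 0)))"

lemma starred_upto_cong:
  assumes "starred_upto \<T> i s" "snd s' = snd s" "fst s' 0 = fst s 0" "fst s' 1 = fst s 1" "fst s' 2 = fst s 2"
  shows "starred_upto \<T> i s'"
  using assms(1) holds_cong[OF _ assms(2-5)] unfolding starred_upto_def by blast

lemma starred_upto_next:
  assumes "holds s lab" "star_labels \<T> lab"
    "\<And>j v. j < i \<Longrightarrow> edge_at j \<inter> \<Union>\<T> = {} \<Longrightarrow> v \<in> edge_at j \<Longrightarrow> lab v \<noteq> 0"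
    "edge_at i \<inter> \<Union>\<T> = {} \<Longrightarrow> \<forall>v\<in>edge_at i. lab v \<noteq> 0"
    and "fst s 3 = i"
  shows "starred_upto \<T> (Suc i) ((fst s)(3 := Suc i), snd s) \<and> fst s 3 = i \<and> fst s 1 = M"
proof -
  have "\<forall>v\<in>edge_at j. lab v \<noteq> 0" if "j < Suc i" "edge_at j \<inter> \<Union>\<T> = {}" for j
    using that assms(3)[of j] assms(4) by (cases "j = i") auto
  moreover have "holds ((fst s)(3 := Suc i), snd s) lab" by (rule holds_cong[OF assms(1)]) simp_all
  ultimately show ?thesis using assms by (auto simp: starred_upto_def holds_regs)
qed

text \<open>\<open>done_or\<close> is what \<open>unlabelled_first\<close> establishes: if the first
  end has a label, so has the second, and skipping is correct.\<close>

lemma runs_join_edge: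
  assumes h: "holds s lab" and star: "star_labels \<T> lab" and i: "fst s 3 = i" "i < M"
    and ab: "fst s 6 = a" "fst s 7 = b" "edge_at i = {a, b}" "edge_at i \<inter> \<Union>\<T> = {}"
    and old: "\<And>j v. j < i \<Longrightarrow> edge_at j \<inter> \<Union>\<T> = {} \<Longrightarrow> v \<in> edge_at j \<Longrightarrow> lab v \<noteq> 0"
    and done_or: "lab a = 0 \<or> lab b \<noteq> 0" and B: "n \<le> B"
  shows "runs B (Cond (eq_exp (label_of 6) (Num 0)) join_star Skip) s
    (\<lambda>s. starred_upto \<T> (Suc i) ((fst s)(3 := Suc i), snd s) \<and> fst s 3 = i \<and> fst s 1 = M)"
proof -
  have e: "{a, b} \<in> E" using edge_at[OF i(2)] ab(3) by simp
  have n: "a < n" "b < n" using edge_endpoints[OF e] by simp_all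
  have T: "a \<notin> \<Union>\<T>" "b \<notin> \<Union>\<T>" using ab(3,4) by auto
  have la: "aval (label_of 6) s = lab a" using aval_label_of[OF h] ab n by auto
  show ?thesis
  proof (rule runs_Cond)
    assume "bval (eq_exp (label_of 6) (Num 0)) s"
    then have a0: "lab a = 0" using la by simp
    have "lab b \<le> n" using star_labels_gt[OF star n(2)] T by simp
    from runs_join_star[OF h ab(1,2) n this B]
    show "runs B join_star s
      (\<lambda>s. starred_upto \<T> (Suc i) ((fst s)(3 := Suc i), snd s) \<and> fst s 3 = i \<and> fst s 1 = M)"
    proof (rule runs_mono)
      fix s' assume s': "holds s' (join a b lab) \<and> fst s' 3 = fst s 3"
      show "starred_upto \<T> (Suc i) ((fst s')(3 := Suc i), snd s') \<and> fst s' 3 = i \<and> fst s' 1 = M"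
      proof (rule starred_upto_next)
        show "star_labels \<T> (join a b lab)" by (rule join_star_labels[OF star e T a0])
        show "join a b lab v \<noteq> 0" if "j < i" "edge_at j \<inter> \<Union>\<T> = {}" "v \<in> edge_at j" for j v
          using old[OF that] by (intro join_nonzero) simp
        show "\<forall>v\<in>edge_at i. join a b lab v \<noteq> 0" unfolding ab(3) using join_nonzero[of lab _ a b] by blast
      qed (use s' i in simp_all)
    qed
  next
    assume "\<not> bval (eq_exp (label_of 6) (Num 0)) s"
    then have "lab a \<noteq> 0" using la by simp
    then have "\<forall>v\<in>edge_at i. lab v \<noteq> 0" using done_or ab(3) by simp
    then show "runs B Skip s
      (\<lambda>s. starred_upto \<T> (Suc i) ((fst s)(3 := Suc i), snd s) \<and> fst s 3 = i \<and> fst s 1 = M)"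
      using starred_upto_next[OF h star old _ i(1)] by (intro runs_loop_free) simp_all
  qed
qed

lemma runs_build_stars:
  assumes "starred_upto \<T> 0 s" and B: "n + M \<le> B"
  shows "runs B build_stars s (starred_upto \<T> M)"
  unfolding build_stars_def
proof (rule runs_For[where I = "starred_upto \<T>" and N = M])
  show "starred_upto \<T> 0 ((fst s)(3 := 0), snd s)" by (rule starred_upto_cong[OF assms(1)]) simp_all
  show "M = fst s 1" using assms(1) by (auto simp: starred_upto_def holds_regs)
  fix i r m
  assume i: "i < M" and p: "starred_upto \<T> i (r, m)" and r: "r 3 = i" "r 1 = M"
  define a b where "a = fst (es ! i)" and "b = snd (es ! i)"
  have e: "edge_at i = {a, b}" by (simp add: edge_at_def a_def b_def)
  have abn: "a < n" "b < n" "{a, b} \<in> E" using ends[OF i] by (simp_all add: a_def b_def)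
  obtain lab where h0: "holds (r, m) lab" and star: "star_labels \<T> lab"
    and old: "\<And>j v. j < i \<Longrightarrow> edge_at j \<inter> \<Union>\<T> = {} \<Longrightarrow> v \<in> edge_at j \<Longrightarrow> lab v \<noteq> 0"
    using p unfolding starred_upto_def by blast
  define s1 where "s1 = (r(6 := a, 7 := b), m)"
  have load: "run load_edge (r, m) = s1"
    using run_load_edge[OF h0] i r by (simp add: s1_def a_def b_def)
  have h: "holds s1 lab" by (rule holds_cong[OF h0]) (simp_all add: s1_def)
  have s1: "fst s1 0 = n" "fst s1 3 = i" "fst s1 6 = a" "fst s1 7 = b"
    using r holds_regs(1)[OF h0] by (simp_all add: s1_def)
  have la: "aval (label_of 6) s1 = lab a" and lb: "aval (label_of 7) s1 = lab b"
    using aval_label_of[OF h] abn s1 by auto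
  let ?Q = "\<lambda>s. starred_upto \<T> (Suc i) ((fst s)(3 := Suc i), snd s) \<and> fst s 3 = i \<and> fst s 1 = M"
  let ?C = "Cond (eq_exp (label_of 6) (Num 0)) join_star Skip"
  have skip: "runs B Skip s1 ?Q" if "edge_at i \<inter> \<Union>\<T> \<noteq> {}"
    using starred_upto_next[OF h star old _ s1(2)] that by (intro runs_loop_free) simp_all
  have main: "runs B (Seq unlabelled_first ?C) s1 ?Q" if T: "edge_at i \<inter> \<Union>\<T> = {}"
  proof (rule runs_Seq_loop_free)
    show "loop_free unlabelled_first" by (simp add: unlabelled_first_def)
    show "runs B ?C (run unlabelled_first s1) ?Q"
    proof (cases "lab a = 0")
      case True
      then have "run unlabelled_first s1 = s1" using la by (simp add: unlabelled_first_def)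
      then show ?thesis
        using runs_join_edge[OF h star s1(2) i s1(3,4) e T old] True B by simp
    next
      case False
      define s2 where "s2 = ((fst s1)(10 := a, 6 := b, 7 := a), snd s1)"
      have run: "run unlabelled_first s1 = s2"
        using la False s1 by (simp add: unlabelled_first_def s2_def)
      have h2: "holds s2 lab" by (rule holds_cong[OF h]) (simp_all add: s2_def)
      have "edge_at i = {b, a}" using e by auto
      have r2: "fst s2 3 = i" "fst s2 6 = b" "fst s2 7 = a" using s1 by (simp_all add: s2_def)
      \<comment> \<open>After the swap the second end is the labelled \<open>a\<close>, which gives
        \<open>done_or\<close>.\<close>
      show ?thesis unfolding run
        by (rule runs_join_edge[OF h2 star r2(1) i r2(2,3) \<open>edge_at i = {b, a}\<close> T old]) (use False B in simp_all)
    qed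
  qed
  have inT: "n < lab a \<longleftrightarrow> a \<in> \<Union>\<T>" "n < lab b \<longleftrightarrow> b \<in> \<Union>\<T>"
    using star_labels_gt[OF star] abn by simp_all
  have "runs B (Cond (Less (Reg 0) (label_of 6)) Skip (Cond (Less (Reg 0) (label_of 7)) Skip
      (Seq unlabelled_first ?C))) s1 ?Q"
  proof (rule runs_Cond)
    assume "bval (Less (Reg 0) (label_of 6)) s1"
    then have "a \<in> \<Union>\<T>" using la s1 inT by simp
    then have "edge_at i \<inter> \<Union>\<T> \<noteq> {}" using e by blast
    then show "runs B Skip s1 ?Q" by (rule skip)
  next
    assume "\<not> bval (Less (Reg 0) (label_of 6)) s1"
    then have a: "a \<notin> \<Union>\<T>" using la s1 inT by simp
    show "runs B (Cond (Less (Reg 0) (label_of 7)) Skip (Seq unlabelled_first ?C)) s1 ?Q"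
    proof (rule runs_Cond)
      assume "bval (Less (Reg 0) (label_of 7)) s1"
      then have "b \<in> \<Union>\<T>" using lb s1 inT by simp
      then have "edge_at i \<inter> \<Union>\<T> \<noteq> {}" using e by blast
      then show "runs B Skip s1 ?Q" by (rule skip)
    next
      assume "\<not> bval (Less (Reg 0) (label_of 7)) s1"
      then have "b \<notin> \<Union>\<T>" using lb s1 inT by simp
      then have "edge_at i \<inter> \<Union>\<T> = {}" using a by (simp add: e)
      then show "runs B (Seq unlabelled_first ?C) s1 ?Q" by (rule main)
    qed
  qed
  then show "runs B (Seq load_edge (Cond (Less (Reg 0) (label_of 6)) Skip
      (Cond (Less (Reg 0) (label_of 7)) Skip (Seq unlabelled_first ?C)))) (r, m) ?Q"
    unfolding load[symmetric] by (rule runs_Seq_loop_free[rotated]) (simp add: load_edge_def)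
qed (use B in auto)

section \<open>The attaching phase\<close>

definition attached_upto :: "nat set set \<Rightarrow> nat \<Rightarrow> state \<Rightarrow> bool" where
  "attached_upto \<T> i s \<longleftrightarrow> (\<exists>lab. holds s lab \<and> attached_labels \<T> lab \<and>
     (\<forall>j<i. \<forall>v\<in>edge_at j. lab v \<noteq> 0))"

lemma attached_upto_cong:
  assumes "attached_upto \<T> i s" "snd s' = snd s" "fst s' 0 = fst s 0" "fst s' 1 = fst s 1" "fst s' 2 = fst s 2"
  shows "attached_upto \<T> i s'"
  using assms(1) holds_cong[OF _ assms(2-5)] unfolding attached_upto_def by blast

lemma run_attach:
  assumes h: "holds s lab" and att: "attached_labels \<T> lab"
    and ab: "fst s x = a" "fst s y = b" "{a, b} \<in> E"
  shows "\<exists>lab'. holds (run (Cond (eq_exp (label_of x) (Num 0)) (set_label x (label_of y)) Skip) s) lab' \<and>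
      attached_labels \<T> lab' \<and> lab' a \<noteq> 0 \<and> (\<forall>v. lab v \<noteq> 0 \<longrightarrow> lab' v \<noteq> 0) \<and>
      fst (run (Cond (eq_exp (label_of x) (Num 0)) (set_label x (label_of y)) Skip) s) = fst s"
proof -
  have n: "a < n" "b < n" using edge_endpoints[OF ab(3)] by simp_all
  have l: "aval (label_of x) s = lab a" "aval (label_of y) s = lab b"
    using aval_label_of[OF h] ab n by auto
  show ?thesis
  proof (cases "lab a = 0")
    case True
    have "holds (run (set_label x (label_of y)) s) (lab(a := lab b))"
      "fst (run (set_label x (label_of y)) s) = fst s"
      using holds_run_set_label[OF h, of x "label_of y"] ab n l by simp_all
    then show ?thesis
      using attach[OF att ab(3) True] True l by (intro exI[of _ "lab(a := lab b)"]) simp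
  next
    case False
    then show ?thesis using h att l by (intro exI[of _ lab]) simp
  qed
qed

lemma runs_attach_isolated:
  assumes "attached_upto \<T> 0 s" and B: "n + M \<le> B"
  shows "runs B attach_isolated s (attached_upto \<T> M)"
  unfolding attach_isolated_def
proof (rule runs_For[where I = "attached_upto \<T>" and N = M])
  show "attached_upto \<T> 0 ((fst s)(3 := 0), snd s)" by (rule attached_upto_cong[OF assms(1)]) simp_all
  show "M = fst s 1" using assms(1) by (auto simp: attached_upto_def holds_regs)
  fix i r m
  assume i: "i < M" and p: "attached_upto \<T> i (r, m)" and r: "r 3 = i" "r 1 = M"
  define a b where "a = fst (es ! i)" and "b = snd (es ! i)"
  have e: "edge_at i = {a, b}" by (simp add: edge_at_def a_def b_def)
  have E: "{a, b} \<in> E" "{b, a} \<in> E" using ends[OF i] by (simp_all add: a_def b_def insert_commute)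
  obtain lab where h0: "holds (r, m) lab" and att: "attached_labels \<T> lab"
    and old: "\<And>j v. j < i \<Longrightarrow> v \<in> edge_at j \<Longrightarrow> lab v \<noteq> 0"
    using p unfolding attached_upto_def by blast
  define s1 where "s1 = (r(6 := a, 7 := b), m)"
  have load: "run load_edge (r, m) = s1"
    using run_load_edge[OF h0] i r by (simp add: s1_def a_def b_def)
  have h: "holds s1 lab" by (rule holds_cong[OF h0]) (simp_all add: s1_def)
  let ?c = "Cond (eq_exp (label_of 6) (Num 0)) (set_label 6 (label_of 7)) Skip"
  let ?d = "Cond (eq_exp (label_of 7) (Num 0)) (set_label 7 (label_of 6)) Skip"
  have s1: "fst s1 6 = a" "fst s1 7 = b" by (simp_all add: s1_def)
  obtain lab2 where 2: "holds (run ?c s1) lab2" "attached_labels \<T> lab2" "lab2 a \<noteq> 0"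
    "\<And>v. lab v \<noteq> 0 \<Longrightarrow> lab2 v \<noteq> 0" "fst (run ?c s1) = fst s1"
    using run_attach[OF h att s1 E(1)] by blast
  have s2: "fst (run ?c s1) 7 = b" "fst (run ?c s1) 6 = a" unfolding 2(5) by (simp_all add: s1)
  obtain lab3 where 3: "holds (run ?d (run ?c s1)) lab3" "attached_labels \<T> lab3" "lab3 b \<noteq> 0"
    "\<And>v. lab2 v \<noteq> 0 \<Longrightarrow> lab3 v \<noteq> 0" "fst (run ?d (run ?c s1)) = fst (run ?c s1)"
    using run_attach[OF 2(1,2) s2 E(2)] by blast
  have "lab3 v \<noteq> 0" if "j < Suc i" "v \<in> edge_at j" for j v
  proof (cases "j = i")
    case True
    then have "v = a \<or> v = b" using that e by blast
    then show ?thesis using 3(3) 3(4)[OF 2(3)] by blast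
  next
    case False
    then show ?thesis using that old[of j v] 2(4)[of v] 3(4)[of v] by simp
  qed
  then have "attached_upto \<T> (Suc i) (run ?d (run ?c s1))"
    using 3(1,2) unfolding attached_upto_def by blast
  note final = attached_upto_cong[OF this, of "((fst (run ?d (run ?c s1)))(3 := Suc i), snd (run ?d (run ?c s1)))"]
  have regs: "fst (run ?d (run ?c s1)) 3 = i" "fst (run ?d (run ?c s1)) 1 = M"
    unfolding 3(5) 2(5) using r by (simp_all add: s1_def)
  show "runs B (Seq load_edge (Seq ?c ?d)) (r, m)
      (\<lambda>s. attached_upto \<T> (Suc i) ((fst s)(3 := Suc i), snd s) \<and> fst s 3 = i \<and> fst s 1 = M)"
  proof (rule runs_loop_free)
    show "loop_free (Seq load_edge (Seq ?c ?d))" by (simp add: load_edge_def set_label_def)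
    have "run (Seq load_edge (Seq ?c ?d)) (r, m) = run ?d (run ?c s1)"
      by (simp only: run.simps(4) load)
    then show "attached_upto \<T> (Suc i) ((fst (run (Seq load_edge (Seq ?c ?d)) (r, m)))(3 := Suc i),
        snd (run (Seq load_edge (Seq ?c ?d)) (r, m))) \<and>
        fst (run (Seq load_edge (Seq ?c ?d)) (r, m)) 3 = i \<and>
        fst (run (Seq load_edge (Seq ?c ?d)) (r, m)) 1 = M"
      using final regs by (simp del: run.simps)
  qed
qed (use B in auto)

text \<open>The copies may overwrite the edge list, so the invariant no longer mentions it; the
  label table lies beyond all cells written.\<close>

lemma runs_copy_labels:
  assumes h: "holds s lab" and B: "n \<le> B"
  shows "runs B copy_labels s (\<lambda>s'. \<forall>v<n. snd s' v = lab v)"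
  unfolding copy_labels_def
proof (rule runs_For[where N = n and I = "\<lambda>w s. fst s 2 = n + (M + M) \<and>
    (\<forall>v<n. snd s (n + (M + M) + v) = lab v) \<and> (\<forall>v<w. snd s v = lab v)"])
  fix w :: nat and r m :: "nat \<Rightarrow> nat"
  assume w: "w < n" and I: "fst (r, m) 2 = n + (M + M) \<and>
    (\<forall>v<n. snd (r, m) (n + (M + M) + v) = lab v) \<and> (\<forall>v<w. snd (r, m) v = lab v)"
    and r: "r 4 = w" "r 0 = n"
  have "run (SetMem (Reg 4) (label_of 4)) (r, m) = (r, m(w := lab w))"
    using I r w by (simp add: label_of_def)
  then show "runs B (SetMem (Reg 4) (label_of 4)) (r, m)
    (\<lambda>s. (fst ((fst s)(4 := Suc w), snd s) 2 = n + (M + M) \<and>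
      (\<forall>v<n. snd ((fst s)(4 := Suc w), snd s) (n + (M + M) + v) = lab v) \<and>
      (\<forall>v<Suc w. snd ((fst s)(4 := Suc w), snd s) v = lab v)) \<and> fst s 4 = w \<and> fst s 0 = n)"
    using I r w by (intro runs_loop_free) (auto simp: less_Suc_eq simp del: run.simps)
qed (use h B in \<open>auto simp: holds_def\<close>)

section \<open>Composition of the phases\<close>

lemma holds_initially:
  assumes "\<And>x. x \<noteq> 2 \<Longrightarrow> r x = fst (input_state n es) x" "r 2 = n + (M + M)"
  shows "holds (r, snd (input_state n es)) (\<lambda>_. 0)"
  using assms by (auto simp: holds_def input_state_def)

lemma runs_algorithm:
  assumes B: "n + M \<le> B"
  shows "runs B algorithm (input_state n es) (\<lambda>s. \<exists>\<T> lab.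
    (\<forall>T\<in>\<T>. triangle T) \<and> disjoint \<T> \<and> (\<forall>T. triangle T \<longrightarrow> T \<inter> \<Union>\<T> \<noteq> {}) \<and>
    attached_labels \<T> lab \<and> (\<forall>v<n. lab v \<noteq> 0) \<and> (\<forall>v<n. snd s v = lab v))"
    (is "runs B algorithm _ ?Q")
  unfolding algorithm_def
proof (rule runs_Seq_loop_free)
  let ?s = "run (SetReg 2 (Plus (Reg 0) (Plus (Reg 1) (Reg 1)))) (input_state n es)"
  have h: "holds ?s (\<lambda>_. 0)"
    using holds_initially[of "fst ?s"] by (simp add: input_state_def)
  show "runs B (Seq pack_triangles (Seq build_stars (Seq attach_isolated copy_labels))) ?s ?Q"
  proof (rule runs_Seq[OF runs_pack_triangles[OF h B]])
    fix s assume "packed_upto M 0 s"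
    then obtain \<T> lab where 1: "holds s lab" "packing_labels \<T> lab"
      "\<And>j T. j < M \<Longrightarrow> triangle T \<Longrightarrow> edge_at j \<subseteq> T \<Longrightarrow> T \<inter> \<Union>\<T> \<noteq> {}"
      unfolding packed_upto_def by blast
    \<comment> \<open>Every triangle contains an edge, and every edge occurs in the list, so the
      loop over edges has met all triangles.\<close>
    have max: "T \<inter> \<Union>\<T> \<noteq> {}" if T: "triangle T" for T
    proof -
      obtain x y z where "T = {x, y, z}" "x \<noteq> y" using T by (auto simp: triangle_def card_3_iff)
      then have xy: "{x, y} \<in> E" "{x, y} \<subseteq> T" using T by (auto simp: triangle_def clique_def)
      obtain j where j: "j < M" "edge_at j = {x, y}" using edge_at_surj[OF xy(1)] by blast
      show ?thesis by (rule 1(3)[OF j(1) T]) (simp only: j(2) xy(2))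
    qed
    have "starred_upto \<T> 0 s"
      using 1 packing_labels_imp_star_labels unfolding starred_upto_def by blast
    note stars = runs_build_stars[OF this B]
    show "runs B (Seq build_stars (Seq attach_isolated copy_labels)) s ?Q"
    proof (rule runs_Seq[OF stars])
      fix s assume "starred_upto \<T> M s"
      then obtain lab where 2: "holds s lab" "star_labels \<T> lab"
        "\<And>j v. j < M \<Longrightarrow> edge_at j \<inter> \<Union>\<T> = {} \<Longrightarrow> v \<in> edge_at j \<Longrightarrow> lab v \<noteq> 0"
        unfolding starred_upto_def by blast
      have "attached_labels \<T> lab"
      proof (rule star_labels_imp_attached_labels[OF 2(2)])
        fix u v assume uv: "{u, v} \<in> E" "u \<notin> \<Union>\<T>" "v \<notin> \<Union>\<T>"
        then obtain j where "j < M" "edge_at j = {u, v}" using edge_at_surj by blast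
        then show "lab u \<noteq> 0" using 2(3)[of j u] uv by simp
      qed
      then have "attached_upto \<T> 0 s" using 2 unfolding attached_upto_def by blast
      note attached = runs_attach_isolated[OF this B]
      show "runs B (Seq attach_isolated copy_labels) s ?Q"
      proof (rule runs_Seq[OF attached])
        fix s assume "attached_upto \<T> M s"
        then obtain lab where 3: "holds s lab" "attached_labels \<T> lab"
          "\<And>j v. j < M \<Longrightarrow> v \<in> edge_at j \<Longrightarrow> lab v \<noteq> 0"
          unfolding attached_upto_def by blast
        \<comment> \<open>Degree three puts every vertex on some edge, and all ends of edges are
          labelled.\<close>
        have "lab v \<noteq> 0" if v: "v < n" for v
        proof -
          have "neighbours E v \<noteq> {}" using card_neighbours[of v] v by auto
          then obtain u where "{v, u} \<in> E" by (auto simp: neighbours_def)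
          then obtain j where "j < M" "edge_at j = {v, u}" using edge_at_surj by blast
          then show ?thesis using 3(3)[of j v] by simp
        qed
        moreover have "\<forall>T\<in>\<T>. triangle T" "disjoint \<T>" using 1(2) by (simp_all add: packing_labels_def)
        moreover have "n \<le> B" using B by simp
        ultimately show "runs B copy_labels s ?Q"
          using 3(2) max by (intro runs_mono[OF runs_copy_labels[OF 3(1)]]) blast+
      qed
    qed
  qed
qed simp

end

theorem theorem15:
  "\<exists>(alg::com) (p::nat poly). \<forall>n es V E. cubic_graph V E \<and> encodes_graph n es V E \<longrightarrow>
     (\<exists>t s. exec alg (input_state n es) t s \<and> t \<le> poly p (card V + card E) \<and>
       partition_on V (output_partition V s) \<and>
       0 < partition_density E (output_partition V s) \<and>
       opt_density V E / partition_density E (output_partition V s) \<le> 4 / 3)"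
proof -
  obtain p where p: "\<And>B. cost_bound B algorithm = poly p B" using cost_bound_polynomial by blast
  show ?thesis
  proof (intro exI[of _ algorithm] exI[of _ p] allI impI, elim conjE)
    fix n es and V :: "nat set" and E
    assume cubic: "cubic_graph V E" and enc: "encodes_graph n es V E"
    have V: "V = {..<n}" using enc by (simp add: encodes_graph_def)
    interpret encoded_cubic n E es
      using cubic enc unfolding V by unfold_locales
    have "card E = length es"
      using enc distinct_card[of "map (\<lambda>(u, v). {u, v}) es"] by (simp add: encodes_graph_def)
    \<comment> \<open>Every loop runs over the vertices or over the edges, so
      \<open>card V + card E\<close> can serve as the iteration bound \<open>B\<close>.\<close>
    then have B: "n + length es \<le> card V + card E" by (simp add: V)
    obtain t s \<T> lab where t: "exec algorithm (input_state n es) t s" "t \<le> poly p (card V + card E)"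
      and *: "\<And>T. T \<in> \<T> \<Longrightarrow> triangle T" "disjoint \<T>" "\<And>T. triangle T \<Longrightarrow> T \<inter> \<Union>\<T> \<noteq> {}"
        "attached_labels \<T> lab" "\<And>v. v < n \<Longrightarrow> lab v \<noteq> 0" and out: "\<And>v. v < n \<Longrightarrow> snd s v = lab v"
      using runs_algorithm[OF B] unfolding runs_def p by blast
    let ?Q = "output_partition V s"
    have Q: "?Q = (\<lambda>v. {u \<in> {..<n}. lab u = lab v}) ` {..<n}"
      unfolding output_partition_def V using out by (intro image_cong) auto
    note approx = attached_labels_approximation[OF *, folded Q V]
    have "opt_density V E \<le> 4 / 3 * partition_density E ?Q"
      unfolding opt_density_def
    proof (rule Max.boundedI)
      show "finite (partition_density E ` {P. partition_on V P})"
        using finitely_many_partition_on[of V] by (simp add: V)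
      show "partition_density E ` {P. partition_on V P} \<noteq> {}" using approx(1) by blast
    qed (use approx(3) in blast)
    \<comment> \<open>Dividing is legitimate because \<open>approx(2)\<close> makes the density of
      the output positive.\<close>
    then have "opt_density V E / partition_density E ?Q \<le> 4 / 3"
      using approx(2) by (simp add: field_simps)
    then show "\<exists>t s. exec algorithm (input_state n es) t s \<and> t \<le> poly p (card V + card E) \<and>
       partition_on V (output_partition V s) \<and>
       0 < partition_density E (output_partition V s) \<and>
       opt_density V E / partition_density E (output_partition V s) \<le> 4 / 3"
      using t approx(1,2) by blast
  qed
qed

end
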